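(* Let $N\in\mathbb{N}$, $m\ge 0$, $\gamma=\frac{m+2}{2}$, $\beta>0$, let $W_{\beta,m}:\mathbb{R}^N\times\mathbb{R}_{\ge0}\to\mathbb{R}_{>0}$ be the function $W_{\beta,m}(x,t)=\int_0^1 y_{\lambda,m}(t)\,\varphi_\lambda(x)\,\lambda^{\beta-1}\,d\lambda$, let $T_0=T_0(m)\ge1$ be the constant described in the context, and let $r_0>0$. Then the following hold. 1. There is a constant $C=C(m)>1$ such that for all $(x,t)\in\mathbb{R}^N\times(1,\infty)$, $$|\partial_tW_{\beta,m}(x,t)|\le C\exp(t^{-\gamma}|x|)\,t^{-\gamma(\beta+\frac1\gamma)}+C\,t^{\frac m2}\,W_{\beta+1,m}(x,t).$$ 2. There is a constant $C=C(m,\beta)>0$ such that for all $(x,t)\in\mathbb{R}^N\times\big((2T_0)^{\frac1\gamma},\infty\big)$, $$W_{\beta,m}(x,t)\ge C\,t^{-\frac{m+2}{2}\beta}.$$ 3. If $\beta>\frac N2-\frac1{m+2}$, then there is a constant $C=C(N,m,\beta,r_0)>0$ such that for all $(x,t)\in\mathbb{R}^N\times\big(T_0^{\frac1\gamma},\infty\big)$ with $|x|<r_0+\frac1\gamma t^\gamma$, $$W_{\beta,m}(x,t)\le C\,t^{-\frac m4-\frac{(N-1)(m+2)}{4}}\left(r_0+\frac1\gamma t^\gamma-|x|\right)^{-\beta-\frac1{m+2}+\frac N2}.$$ 4. If $N\ge2$ and $\frac12-\frac1{m+2}<\beta<\frac N2-\frac1{m+2}$, then there is a constant $C=C(N,m,\beta,r_0)>0$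 such that for all $(x,t)\in\mathbb{R}^N\times\big(T_0^{\frac1\gamma},\infty\big)$ with $|x|<r_0+\frac1\gamma t^\gamma$, $$W_{\beta,m}(x,t)\le C\,t^{-\frac m4}\left(r_0+\frac1\gamma t^\gamma+|x|\right)^{-\beta+\frac12-\frac1{m+2}}.$$
   Context: For $m\ge0$ put $\gamma=\gamma(m):=\frac{m+2}{2}$. For $\nu>0$ the modified Bessel function of the second kind is $K_\nu(t):=\int_0^\infty e^{-t\cosh z}\cosh(\nu z)\,dz$. For $\lambda>0$ define $$y_{\lambda,m}(t):=C_0\,(\lambda^{\frac1\gamma}t)^{\frac12}\,K_{\frac1{2\gamma}}\!\left(\gamma^{-1}(\lambda^{\frac1\gamma}t)^\gamma\right),\qquad C_0:=\gamma^{-\frac1{2\gamma}}\,2^{1-\frac1{2\gamma}}\,\Gamma\!\left(\tfrac1{2\gamma}\right)^{-1},\qquad t\ge0,$$ where $\Gamma$ is the Gamma function and the value at $t=0$ is the limit $t\to+0$, so $y_{\lambda,m}(0)=1$; $y_{\lambda,m}$ solves $y''-\lambda^2t^my=0$. Define $\varphi:\mathbb{R}^N\to\mathbb{R}_{>0}$ by $\varphi(x):=\frac1{|\mathbb{S}^{N-1}|}\int_{\mathbb{S}^{N-1}}e^{x\cdot\omega}\,d\omega$ if $N\ge2$ and $\varphi(x):=\frac12(e^x+e^{-x})$ if $N=1$, and for $\lambda>0$ put $\varphi_\lambda(x):=\varphi(\lambda x)$. $T_0=T_0(m)\ge1$ is a constant depending only on $m$ such that, for some $C=C(m)>1$, for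 all $\lambda>0$ and all $t\ge0$ with $\lambda t^\gamma\ge T_0$, $$C^{-1}(\lambda^{\frac1\gamma}t)^{-\frac m4}\exp\left(-\gamma^{-1}(\lambda^{\frac1\gamma}t)^\gamma\right)\le y_{\lambda,m}(t)\le C(\lambda^{\frac1\gamma}t)^{-\frac m4}\exp\left(-\gamma^{-1}(\lambda^{\frac1\gamma}t)^\gamma\right)$$ (such a constant exists). *)

theory Defs
  imports "HOL-Analysis.Analysis"
begin

text \<open>
  Some constants in the theorem are uniform in the dimension \<open>N\<close>, so \<open>N\<close> has to be quantified
  inside the statement and cannot be a type. Points of Euclidean \<open>N\<close>-space are therefore the
  elements of \<open>{..<N} \<rightarrow>\<^sub>E UNIV\<close>, the space of the \<open>N\<close>-fold product of Lebesgue measure;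
  coordinates are \<open>x 0, \<dots>, x (N - 1)\<close>.
\<close>

definition lebesgue_Rn :: "nat \<Rightarrow> (nat \<Rightarrow> real) measure" where
  "lebesgue_Rn N = Pi\<^sub>M {..<N} (\<lambda>_. lborel)"

definition Rn :: "nat \<Rightarrow> (nat \<Rightarrow> real) set" where
  "Rn N = {..<N} \<rightarrow>\<^sub>E UNIV"

definition norm_Rn :: "nat \<Rightarrow> (nat \<Rightarrow> real) \<Rightarrow> real" where
  "norm_Rn N x = L2_set x {..<N}"

definition inner_Rn :: "nat \<Rightarrow> (nat \<Rightarrow> real) \<Rightarrow> (nat \<Rightarrow> real) \<Rightarrow> real" where
  "inner_Rn N x y = (\<Sum>i<N. x i * y i)"

definition scale_Rn :: "nat \<Rightarrow> real \<Rightarrow> (nat \<Rightarrow> real) \<Rightarrow> (nat \<Rightarrow> real)" where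
  "scale_Rn N c x = (\<lambda>i\<in>{..<N}. c * x i)"

definition unit_sphere_Rn :: "nat \<Rightarrow> (nat \<Rightarrow> real) set" where
  "unit_sphere_Rn N = {x \<in> Rn N. norm_Rn N x = 1}"

text \<open>
  The surface measure on the unit sphere, given by polar coordinates: a set \<open>A\<close> of directions has
  measure \<open>N\<close> times the Lebesgue measure of the cone \<open>{r \<omega> | 0 < r \<le> 1, \<omega> \<in> A}\<close>
  (see \<open>emeasure_surface_measure\<close> below).
\<close>

definition surface_measure :: "nat \<Rightarrow> (nat \<Rightarrow> real) measure" where
  "surface_measure N = scale_measure (of_nat N)
     (distr (restrict_space (lebesgue_Rn N) {x \<in> Rn N. 0 < norm_Rn N x \<and> norm_Rn N x \<le> 1})
        (restrict_space (lebesgue_Rn N) (unit_sphere_Rn N))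
        (\<lambda>x. scale_Rn N (1 / norm_Rn N x) x))"

definition phi :: "nat \<Rightarrow> (nat \<Rightarrow> real) \<Rightarrow> real" where
  "phi N x = (if N = 1 then (exp (x 0) + exp (- x 0)) / 2
     else (1 / measure (surface_measure N) (unit_sphere_Rn N)) *
       (LINT \<omega>|surface_measure N. exp (inner_Rn N x \<omega>)))"

definition phi_scaled :: "nat \<Rightarrow> real \<Rightarrow> (nat \<Rightarrow> real) \<Rightarrow> real" where
  "phi_scaled N l x = phi N (scale_Rn N l x)"

definition gam :: "real \<Rightarrow> real" where
  "gam m = (m + 2) / 2"

definition bessel_K :: "real \<Rightarrow> real \<Rightarrow> real" where
  "bessel_K \<nu> t = (LBINT z:{0..}. exp (- t * cosh z) * cosh (\<nu> * z))"

definition C0 :: "real \<Rightarrow> real" where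
  "C0 m = gam m powr (- (1 / (2 * gam m))) * 2 powr (1 - 1 / (2 * gam m)) / Gamma (1 / (2 * gam m))"

definition ysol_formula :: "real \<Rightarrow> real \<Rightarrow> real \<Rightarrow> real" where
  "ysol_formula l m t = C0 m * (l powr (1 / gam m) * t) powr (1 / 2) *
     bessel_K (1 / (2 * gam m)) (1 / gam m * (l powr (1 / gam m) * t) powr gam m)"

definition ysol :: "real \<Rightarrow> real \<Rightarrow> real \<Rightarrow> real" where
  "ysol l m t = (if t = 0 then Lim (at_right 0) (ysol_formula l m) else ysol_formula l m t)"

definition Wfun :: "nat \<Rightarrow> real \<Rightarrow> real \<Rightarrow> (nat \<Rightarrow> real) \<Rightarrow> real \<Rightarrow> real" where
  "Wfun N \<beta> m x t = (LBINT l:{0<..1}. ysol l m t * phi_scaled N l x * l powr (\<beta> - 1))"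

definition is_T0 :: "real \<Rightarrow> real \<Rightarrow> bool" where
  "is_T0 m T0 \<longleftrightarrow> 1 \<le> T0 \<and>
     (\<exists>C>1. \<forall>l>0. \<forall>t\<ge>0. T0 \<le> l * t powr gam m \<longrightarrow>
        1 / C * (l powr (1 / gam m) * t) powr (- (m / 4)) *
            exp (- (1 / gam m * (l powr (1 / gam m) * t) powr gam m)) \<le> ysol l m t \<and>
        ysol l m t \<le> C * (l powr (1 / gam m) * t) powr (- (m / 4)) *
            exp (- (1 / gam m * (l powr (1 / gam m) * t) powr gam m)))"

lemma space_lebesgue_Rn: "space (lebesgue_Rn N) = Rn N"
  by (simp add: lebesgue_Rn_def Rn_def space_PiM)

lemma norm_Rn_measurable [measurable]: "norm_Rn N \<in> borel_measurable (lebesgue_Rn N)"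
  unfolding norm_Rn_def L2_set_def lebesgue_Rn_def by measurable

lemma norm_scale_Rn: "norm_Rn N (scale_Rn N c x) = \<bar>c\<bar> * norm_Rn N x"
proof -
  have "(\<Sum>i<N. (scale_Rn N c x i)\<^sup>2) = c\<^sup>2 * (\<Sum>i<N. (x i)\<^sup>2)"
    by (simp add: scale_Rn_def sum_distrib_left power_mult_distrib)
  then show ?thesis
    by (simp add: norm_Rn_def L2_set_def real_sqrt_mult)
qed

lemma scale_norm_measurable:
  "(\<lambda>x. scale_Rn N (1 / norm_Rn N x) x) \<in> lebesgue_Rn N \<rightarrow>\<^sub>M lebesgue_Rn N"
proof -
  have "(\<lambda>x. x i) \<in> borel_measurable (lebesgue_Rn N)" if "i < N" for i
  proof -
    have "i \<in> {..<N}" using that by simp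
    then have "(\<lambda>x. x i) \<in> lebesgue_Rn N \<rightarrow>\<^sub>M lborel"
      unfolding lebesgue_Rn_def by (rule measurable_component_singleton)
    then show ?thesis by simp
  qed
  then have "(\<lambda>x. 1 / norm_Rn N x * x i) \<in> lebesgue_Rn N \<rightarrow>\<^sub>M lborel" if "i < N" for i
    using that by measurable
  then show ?thesis
    unfolding scale_Rn_def lebesgue_Rn_def[of N] by (intro measurable_restrict) auto
qed

lemma sets_unit_sphere_Rn: "unit_sphere_Rn N \<in> sets (lebesgue_Rn N)"
proof -
  have "unit_sphere_Rn N = {x \<in> space (lebesgue_Rn N). norm_Rn N x = 1}"
    by (simp add: unit_sphere_Rn_def space_lebesgue_Rn)
  also have "\<dots> \<in> sets (lebesgue_Rn N)" by measurable
  finally show ?thesis .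
qed

lemma emeasure_surface_measure:
  assumes "A \<in> sets (lebesgue_Rn N)" "A \<subseteq> unit_sphere_Rn N"
  shows "emeasure (surface_measure N) A = of_nat N *
    emeasure (lebesgue_Rn N) {x \<in> Rn N. \<exists>r \<omega>. 0 < r \<and> r \<le> 1 \<and> \<omega> \<in> A \<and> x = scale_Rn N r \<omega>}"
proof -
  let ?L = "lebesgue_Rn N"
  let ?p = "\<lambda>x. scale_Rn N (1 / norm_Rn N x) x"
  let ?B = "{x \<in> Rn N. 0 < norm_Rn N x \<and> norm_Rn N x \<le> 1}"
  have "{x \<in> space ?L. 0 < norm_Rn N x \<and> norm_Rn N x \<le> 1} \<in> sets ?L"
    by measurable
  then have B: "?B \<in> sets ?L" by (simp add: space_lebesgue_Rn)
  have p: "?p \<in> restrict_space ?L ?B \<rightarrow>\<^sub>M restrict_space ?L (unit_sphere_Rn N)"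
  proof (rule measurable_restrict_space3[OF scale_norm_measurable])
    show "?p \<in> ?B \<rightarrow> unit_sphere_Rn N"
    proof
      fix x assume "x \<in> ?B"
      then have "norm_Rn N (?p x) = 1" unfolding norm_scale_Rn by simp
      moreover have "?p x \<in> Rn N" by (simp add: Rn_def scale_Rn_def)
      ultimately show "?p x \<in> unit_sphere_Rn N" by (simp add: unit_sphere_Rn_def)
    qed
  qed
  have A: "A \<in> sets (restrict_space ?L (unit_sphere_Rn N))"
  proof -
    have "A = unit_sphere_Rn N \<inter> A" using assms(2) by blast
    then show ?thesis unfolding sets_restrict_space using assms(1) by (rule image_eqI)
  qed
  have eq: "?p -` A \<inter> ?B = {x \<in> Rn N. \<exists>r \<omega>. 0 < r \<and> r \<le> 1 \<and> \<omega> \<in> A \<and> x = scale_Rn N r \<omega>}"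
    (is "_ = ?C")
  proof (intro equalityI subsetI)
    fix x assume x: "x \<in> ?p -` A \<inter> ?B"
    then have "x = scale_Rn N (norm_Rn N x) (?p x)"
      by (auto simp: scale_Rn_def Rn_def fun_eq_iff PiE_def extensional_def)
    with x show "x \<in> ?C" by blast
  next
    fix x assume "x \<in> ?C"
    then obtain r \<omega> where r: "x \<in> Rn N" "0 < r" "r \<le> 1" "\<omega> \<in> A" "x = scale_Rn N r \<omega>" by blast
    with assms(2) have w: "\<omega> \<in> Rn N" "norm_Rn N \<omega> = 1" by (auto simp: unit_sphere_Rn_def)
    with r have n: "norm_Rn N x = r" by (simp add: norm_scale_Rn)
    with r w have "?p x = \<omega>"
      by (auto simp: scale_Rn_def Rn_def fun_eq_iff PiE_def extensional_def)
    with r n show "x \<in> ?p -` A \<inter> ?B" by simp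
  qed
  have sub: "?B \<subseteq> space ?L" by (auto simp: space_lebesgue_Rn)
  have "emeasure (distr (restrict_space ?L ?B) (restrict_space ?L (unit_sphere_Rn N)) ?p) A
      = emeasure (restrict_space ?L ?B) (?p -` A \<inter> ?B)"
    using sub by (subst emeasure_distr[OF p A]) (simp add: space_restrict_space Int_absorb1 Int_absorb2)
  also have "\<dots> = emeasure ?L (?p -` A \<inter> ?B)"
    using B sub by (intro emeasure_restrict_space) (auto simp: Int_absorb1)
  finally show ?thesis
    by (simp add: surface_measure_def eq)
qed

end

theory Submission
  imports Defs "HOL-Real_Asymp.Real_Asymp"
begin

text \<open>
  With \<open>\<tau> = t\<^sup>\<gamma>\<close> and \<open>\<nu> = 1 / (2 \<gamma>)\<close>, the solution is \<open>y\<^sub>\<lambda>(t) = Y(\<lambda> \<tau>)\<close> for one decreasing profile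
  \<open>Y\<close>, a multiple of \<open>s\<^sup>\<nu> K\<^sub>\<nu>(s / \<gamma>)\<close>. Its slope is a multiple of \<open>s\<^sup>\<nu> K\<^sub>1\<^sub>-\<^sub>\<nu>(s / \<gamma>)\<close>; it is
  dominated by \<open>s powr (2 \<nu> - 1)\<close>, and by \<open>Y(s)\<close> for \<open>s \<ge> 1\<close>, so part 1 follows by differentiating
  under the integral and splitting it at \<open>\<lambda> = 1 / \<tau>\<close>. For part 2, restrict the integral to
  \<open>\<lambda> \<le> 1 / \<tau>\<close> and use \<open>\<phi> \<ge> 1\<close>. For parts 3 and 4, the decay of \<open>Y\<close> and the bound
  \<open>\<phi>(x) \<le> C |x| powr (- (N - 1) / 2) exp |x|\<close>, which comes from comparing the spherical average with a
  Gaussian integral over an annulus, leave integrals of Gamma type; the ranges \<open>|x| < \<tau> / (2 \<gamma>)\<close> and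
  \<open>|x| \<ge> \<tau> / (2 \<gamma>)\<close> are treated separately.
\<close>

section \<open>Bessel functions and the profile of \<open>y\<close>\<close>

text \<open>Uniformity shapes part 1: its constant may depend on neither N nor \<beta>. Spherical
  averages therefore enter it only as \<open>phi_scaled\<close> itself and through the bound
  \<open>exp (l * norm_Rn N x)\<close>, and the factor 1 / (2 \<nu> + \<beta>) left by integrating a
  power is replaced by \<gamma>, using 2 \<nu> \<gamma> = 1. Moreover \<open>is_T0\<close> speaks of
  \<open>ysol\<close> and gives nothing about its derivative, so slope and profile are compared
  through the Bessel integrals: monotonicity in the order reduces the comparison to the quotient of
  K of order 1 and K of order 0.

  The upper bounds use \<sigma> = r0 + \<tau> / \<gamma> - |x|. Since l stays in (0, 1], inserting
  r0 into the exponent costs only the factor exp r0, and exp (- \<sigma> * l) turns into a power of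
  \<sigma> when l is rescaled. For \<beta> > N / 2 - \<nu> this power is the one claimed. For
  \<beta> < N / 2 - \<nu>, close to the cone, the exponential is merely bounded by 1, and the power
  decay of the integrand beyond l = 1 / \<tau> makes the integral converge.\<close>

lemma integrable_exp_neg_abs:
  assumes "0 < d"
  shows "integrable lborel (\<lambda>v::real. exp (- d * \<bar>v\<bar>))"
proof -
  define h where "h v = exp (- d * v) * indicator {0..} v" for v :: real
  have [measurable]: "h \<in> borel_measurable borel" unfolding h_def by measurable
  have "(\<integral>\<^sup>+v. ennreal (exp (- d * v)) * indicator {0..} v \<partial>lborel) = ennreal (0 - (- exp (- d * 0) / d))"
  proof (rule nn_integral_FTC_atLeast)
    show "((\<lambda>v. - exp (- d * v) / d) \<longlongrightarrow> 0) at_top"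
      using assms by real_asymp
  qed (use assms in \<open>auto intro!: derivative_eq_intros\<close>)
  then have "(\<integral>\<^sup>+v. ennreal (norm (h v)) \<partial>lborel) < \<infinity>"
    by (simp add: h_def ennreal_mult' ennreal_indicator)
  then have h: "integrable lborel h" by (intro integrableI_bounded) auto
  then have "integrable lborel (\<lambda>v. h (0 + (-1) * v))"
    by (subst lborel_integrable_real_affine_iff) auto
  with h have "integrable lborel (\<lambda>v. h v + h (- v))" by (intro Bochner_Integration.integrable_add) simp_all
  then show ?thesis
    by (rule Bochner_Integration.integrable_bound) (auto simp: h_def indicator_def)
qed


text \<open>Dominated convergence for the difference quotients, which the mean value inequality
  bounds by \<open>g\<close>. Measurability of \<open>f' t\<close> is not assumed; it is inherited
  as a pointwise limit of quotients.\<close>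

lemma has_real_derivative_integral:
  fixes f f' :: "real \<Rightarrow> 'a \<Rightarrow> real"
  assumes t: "a < t" "t < b"
    and f: "\<And>s. a < s \<Longrightarrow> s < b \<Longrightarrow> integrable M (f s)"
    and f': "\<And>x s. x \<in> space M \<Longrightarrow> a < s \<Longrightarrow> s < b \<Longrightarrow> ((\<lambda>s. f s x) has_real_derivative f' s x) (at s)"
    and bound: "\<And>x s. x \<in> space M \<Longrightarrow> a < s \<Longrightarrow> s < b \<Longrightarrow> \<bar>f' s x\<bar> \<le> g x"
    and g: "integrable M g"
  shows "((\<lambda>s. \<integral>x. f s x \<partial>M) has_real_derivative (\<integral>x. f' t x \<partial>M)) (at t)"
    and "integrable M (f' t)"
proof -
  define q where "q s x = (f s x - f t x) / (s - t)" for s x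
  have q_meas: "q s \<in> borel_measurable M" if "a < s" "s < b" for s
    unfolding q_def using f[OF that] f[OF t] by measurable
  have q_lim: "(\<lambda>i. q (X i) x) \<longlonglongrightarrow> f' t x"
    if "x \<in> space M" "\<And>i. X i \<noteq> t" "X \<longlonglongrightarrow> t" for X :: "nat \<Rightarrow> real" and x
  proof -
    have "((\<lambda>s. q s x) \<longlongrightarrow> f' t x) (at t)"
      using f'[OF that(1) t] by (simp add: has_field_derivative_iff q_def)
    then show ?thesis
      using that(2,3) by (auto simp: tendsto_at_iff_sequentially o_def)
  qed
  have q_bound: "\<bar>q s x\<bar> \<le> g x" if "x \<in> space M" "a < s" "s < b" "s \<noteq> t" for s x
  proof -
    have "norm (f s x - f t x) \<le> g x * norm (s - t)"
    proof (rule field_differentiable_bound[of "{a<..<b}"])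
      show "((\<lambda>s. f s x) has_field_derivative f' z x) (at z within {a<..<b})"
        if "z \<in> {a<..<b}" for z
        using f'[OF \<open>x \<in> space M\<close>, of z] that by (auto intro: has_field_derivative_at_within)
    qed (use that t bound in auto)
    then show ?thesis using that by (simp add: q_def abs_divide divide_le_eq)
  qed
  \<comment> \<open>A concrete sequence in (t, b) tending to t, for the measurability of
    \<open>f' t\<close>. The denominators start at 2 to keep \<open>X0 0\<close> below b.\<close>
  define X0 where "X0 i = t + (b - t) / real (i + 2)" for i
  have X0: "a < X0 i" "X0 i < b" "X0 i \<noteq> t" for i
  proof -
    define e where "e = (b - t) / real (i + 2)"
    have "e < (b - t) / 1"
      unfolding e_def using t by (intro divide_strict_left_mono) auto
    moreover have "0 < e" unfolding e_def using t by (intro divide_pos_pos) auto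
    moreover have "X0 i = t + e" by (simp only: X0_def e_def)
    ultimately show "a < X0 i" "X0 i < b" "X0 i \<noteq> t" using t by auto
  qed
  have X0_lim: "X0 \<longlonglongrightarrow> t" unfolding X0_def by real_asymp
  have f'_meas: "f' t \<in> borel_measurable M"
    by (rule borel_measurable_LIMSEQ_real[where u="\<lambda>i. q (X0 i)"]) (use X0 X0_lim q_lim q_meas in auto)
  show "integrable M (f' t)"
    by (rule Bochner_Integration.integrable_bound[OF g f'_meas])
      (use bound[OF _ t] in \<open>auto intro!: AE_I2 order_trans[OF _ abs_ge_self]\<close>)
  have "((\<lambda>s. ((\<integral>x. f s x \<partial>M) - (\<integral>x. f t x \<partial>M)) / (s - t)) \<longlongrightarrow> (\<integral>x. f' t x \<partial>M)) (at t within {a<..<b})"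
    unfolding tendsto_at_iff_sequentially
  proof (intro allI impI)
    fix X :: "nat \<Rightarrow> real" assume X: "\<forall>i. X i \<in> {a<..<b} - {t}" "X \<longlonglongrightarrow> t"
    have "(\<lambda>i. \<integral>x. q (X i) x \<partial>M) \<longlonglongrightarrow> (\<integral>x. f' t x \<partial>M)"
      by (rule integral_dominated_convergence[where w=g])
        (use X q_meas q_lim q_bound f'_meas g in auto)
    also have "(\<lambda>i. \<integral>x. q (X i) x \<partial>M) = (\<lambda>s. ((\<integral>x. f s x \<partial>M) - (\<integral>x. f t x \<partial>M)) / (s - t)) \<circ> X"
      using X f t by (auto simp: fun_eq_iff q_def)
    finally show "((\<lambda>s. ((\<integral>x. f s x \<partial>M) - (\<integral>x. f t x \<partial>M)) / (s - t)) \<circ> X) \<longlonglongrightarrow> (\<integral>x. f' t x \<partial>M)" .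
  qed
  then show "((\<lambda>s. \<integral>x. f s x \<partial>M) has_real_derivative (\<integral>x. f' t x \<partial>M)) (at t)"
    using t by (simp add: has_field_derivative_iff at_within_open[of t "{a<..<b}"])
qed

text \<open>
  Shifting the integration variable of the Bessel integral by \<open>ln u\<close> turns \<open>u\<^sup>a K\<^sub>a(u)\<close> into an integral
  that stays finite at \<open>u = 0\<close> for \<open>a > 0\<close>, and whose derivative in \<open>u\<close> only shifts the order \<open>a\<close>.
\<close>

definition bessel_kernel :: "real \<Rightarrow> real \<Rightarrow> real \<Rightarrow> real" where
  "bessel_kernel a u v = exp (a * v - (exp v + u\<^sup>2 * exp (- v)) / 2)"

definition bessel_line :: "real \<Rightarrow> real \<Rightarrow> real" where
  "bessel_line a u = (\<integral>v. bessel_kernel a u v \<partial>lborel) / 2"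

lemma bessel_kernel_measurable [measurable]: "bessel_kernel a u \<in> borel_measurable borel"
  unfolding bessel_kernel_def by measurable

lemma bessel_kernel_pos [simp]: "0 < bessel_kernel a u v"
  by (simp add: bessel_kernel_def)

text \<open>Completing the square after exp v \<ge> v^2 / 2. The square is taken with a + 1 in place
  of a, so that an integrable factor exp (- v) is left over.\<close>

lemma exp_linear_minus_exp_le:
  fixes a b v :: real
  assumes "0 < b" "0 \<le> v"
  shows "a * v - b * exp v / 2 \<le> (a + 1)\<^sup>2 / b - v"
proof -
  have "v\<^sup>2 / 2 \<le> exp v" using exp_lower_Taylor_quadratic[OF assms(2)] assms(2) by linarith
  then have "b * (v\<^sup>2 / 2) / 2 \<le> b * exp v / 2" using assms(1) by simp
  moreover have "(a + 1) * v \<le> (a + 1)\<^sup>2 / b + b * v\<^sup>2 / 4"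
  proof -
    have "0 \<le> (2 * (a + 1) - b * v)\<^sup>2 / (4 * b)" using assms(1) by simp
    also have "\<dots> = (a + 1)\<^sup>2 / b + b * v\<^sup>2 / 4 - (a + 1) * v"
      using assms(1) by (simp add: field_simps power2_eq_square)
    finally show ?thesis by simp
  qed
  ultimately show ?thesis by (simp add: algebra_simps)
qed

text \<open>The right tail is always tamed by exp v. On the left, exp (a * v) decays if a > 0, which
  admits u = 0; otherwise u^2 * exp (- v) takes over, as a mirror image of the right tail.\<close>

lemma bessel_kernel_integrable:
  assumes "0 < u \<or> 0 < a"
  shows "integrable lborel (bessel_kernel a u)"
proof -
  have pos: "bessel_kernel a u v \<le> exp ((a + 1)\<^sup>2) * exp (- \<bar>v\<bar>)" if "0 \<le> v" for v
  proof -
    have "a * v - (exp v + u\<^sup>2 * exp (- v)) / 2 \<le> a * v - 1 * exp v / 2" by simp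
    also have "\<dots> \<le> (a + 1)\<^sup>2 - v" using exp_linear_minus_exp_le[of 1 v a] that by simp
    finally show ?thesis using that by (simp add: bessel_kernel_def exp_add[symmetric])
  qed
  show ?thesis
  proof (cases "0 < a")
    case True
    have "integrable lborel (\<lambda>v. exp ((a + 1)\<^sup>2) * exp (- 1 * \<bar>v\<bar>) + exp (- a * \<bar>v\<bar>))"
      using True by (intro Bochner_Integration.integrable_add integrable_mult_right integrable_exp_neg_abs) auto
    then show ?thesis
    proof (rule Bochner_Integration.integrable_bound)
      have "bessel_kernel a u v \<le> exp ((a + 1)\<^sup>2) * exp (- 1 * \<bar>v\<bar>) + exp (- a * \<bar>v\<bar>)" for v
      proof (cases "0 \<le> v")
        case False
        have "a * v - (exp v + u\<^sup>2 * exp (- v)) / 2 \<le> a * v" by simp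
        then have "bessel_kernel a u v \<le> exp (- a * \<bar>v\<bar>)" using False by (simp add: bessel_kernel_def)
        then show ?thesis by (simp add: add_increasing)
      qed (use pos[of v] in \<open>simp add: add_increasing2\<close>)
      then show "AE v in lborel. norm (bessel_kernel a u v) \<le> norm (exp ((a + 1)\<^sup>2) * exp (- 1 * \<bar>v\<bar>) + exp (- a * \<bar>v\<bar>))"
        by (intro AE_I2) (simp add: bessel_kernel_def abs_of_nonneg)
    qed simp
  next
    case False
    then have u: "0 < u\<^sup>2" using assms by auto
    define D where "D = exp ((a + 1)\<^sup>2) + exp ((- a + 1)\<^sup>2 / u\<^sup>2)"
    have "integrable lborel (\<lambda>v. D * exp (- 1 * \<bar>v\<bar>))"
      by (intro integrable_mult_right integrable_exp_neg_abs) auto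
    then show ?thesis
    proof (rule Bochner_Integration.integrable_bound)
      have "bessel_kernel a u v \<le> D * exp (- 1 * \<bar>v\<bar>)" for v
      proof (cases "0 \<le> v")
        case True
        then show ?thesis using pos[of v] by (simp add: D_def distrib_right add_increasing2)
      next
        case False
        have "a * v - (exp v + u\<^sup>2 * exp (- v)) / 2 \<le> (- a) * (- v) - u\<^sup>2 * exp (- v) / 2" by simp
        also have "\<dots> \<le> (- a + 1)\<^sup>2 / u\<^sup>2 - (- v)"
          using exp_linear_minus_exp_le[OF u, of "- v" "- a"] False by simp
        finally have "bessel_kernel a u v \<le> exp ((- a + 1)\<^sup>2 / u\<^sup>2) * exp (- 1 * \<bar>v\<bar>)"
          using False by (simp add: bessel_kernel_def exp_add[symmetric])
        then show ?thesis by (simp add: D_def distrib_right add_increasing)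
      qed
      then show "AE v in lborel. norm (bessel_kernel a u v) \<le> norm (D * exp (- 1 * \<bar>v\<bar>))"
        by (intro AE_I2) (simp add: bessel_kernel_def abs_of_nonneg D_def)
    qed simp
  qed
qed

lemma bessel_line_pos:
  assumes "0 < u \<or> 0 < a"
  shows "0 < bessel_line a u"
proof -
  have nonneg: "0 \<le> (\<integral>v. bessel_kernel a u v \<partial>lborel)"
    by (intro Bochner_Integration.integral_nonneg less_imp_le) simp
  have "(\<integral>v. bessel_kernel a u v \<partial>lborel) \<noteq> 0"
  proof
    assume "(\<integral>v. bessel_kernel a u v \<partial>lborel) = 0"
    then have "AE v in lborel. bessel_kernel a u v = 0"
      using integral_nonneg_eq_0_iff_AE[OF bessel_kernel_integrable[OF assms]] by (simp add: less_imp_le)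
    then have "AE v in (lborel :: real measure). False" by (simp add: bessel_kernel_pos[THEN less_imp_neq, symmetric])
    then show False by (simp add: AE_iff_measurable[where N=UNIV])
  qed
  with nonneg show ?thesis by (simp add: bessel_line_def)
qed

lemma bessel_line_antimono:
  assumes "0 < a" "0 \<le> u" "u \<le> u'"
  shows "bessel_line a u' \<le> bessel_line a u"
proof -
  have "u\<^sup>2 \<le> u'\<^sup>2" using assms by (intro power_mono) auto
  then have "bessel_kernel a u' v \<le> bessel_kernel a u v" for v
    by (simp add: bessel_kernel_def mult_right_mono)
  then show ?thesis
    unfolding bessel_line_def
    using assms by (intro divide_right_mono integral_mono bessel_kernel_integrable) auto
qed

text \<open>The classical rule that u^a K_a has derivative - u^a K_(a-1): differentiating the
  exponent yields the factor - u * exp (- v), and exp (- v) lowers the order by one.\<close>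

lemma bessel_line_deriv:
  assumes "0 < u"
  shows "(bessel_line a has_real_derivative - (u * bessel_line (a - 1) u)) (at u)"
proof -
  have "((\<lambda>s. \<integral>v. bessel_kernel a s v \<partial>lborel) has_real_derivative
      (\<integral>v. - u * bessel_kernel (a - 1) u v \<partial>lborel)) (at u)"
  \<comment> \<open>The kernel decreases in positive u, so its value at u / 2 dominates on the whole
    interval, and u / 2 > 0 makes it integrable for every order.\<close>
  proof (rule has_real_derivative_integral(1)[where a="u/2" and b="u + 1" and
        g = "\<lambda>v. (u + 1) * bessel_kernel (a - 1) (u/2) v" and f' = "\<lambda>s v. - s * bessel_kernel (a - 1) s v"])
    fix v s assume s: "u / 2 < s" "s < u + 1"
    show "((\<lambda>s. bessel_kernel a s v) has_real_derivative - s * bessel_kernel (a - 1) s v) (at s)"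
      unfolding bessel_kernel_def
      by (auto intro!: derivative_eq_intros simp: exp_add[symmetric] algebra_simps exp_diff exp_minus divide_simps)
    have "(u/2)\<^sup>2 \<le> s\<^sup>2" using s assms by (intro power_mono) auto
    then have "bessel_kernel (a - 1) s v \<le> bessel_kernel (a - 1) (u/2) v"
      by (simp add: bessel_kernel_def mult_right_mono)
    then have "s * bessel_kernel (a - 1) s v \<le> (u + 1) * bessel_kernel (a - 1) (u/2) v"
      using s assms by (intro mult_mono) (auto simp: bessel_kernel_def)
    then show "\<bar>- s * bessel_kernel (a - 1) s v\<bar> \<le> (u + 1) * bessel_kernel (a - 1) (u/2) v"
      using s assms by (simp add: abs_mult bessel_kernel_def)
  qed (use assms in \<open>auto intro!: bessel_kernel_integrable\<close>)
  then have "((\<lambda>s. (\<integral>v. bessel_kernel a s v \<partial>lborel) / 2) has_real_derivative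
      (\<integral>v. - u * bessel_kernel (a - 1) u v \<partial>lborel) / 2) (at u)"
    by (rule DERIV_cdivide)
  then show ?thesis by (simp add: bessel_line_def[abs_def])
qed

text \<open>The symmetry of K_a in its order: replacing v by 2 ln u - v exchanges exp v and u^2 *
  exp (- v).\<close>

lemma bessel_line_reflect:
  assumes "0 < u"
  shows "bessel_line a u = u powr (2 * a) * bessel_line (- a) u"
proof -
  have "bessel_kernel a u (2 * ln u + (-1) * v) = u powr (2 * a) * bessel_kernel (- a) u v" for v
  proof -
    have e: "exp (2 * ln u) = u\<^sup>2" "exp (- (2 * ln u)) = 1 / u\<^sup>2"
      using assms by (simp_all add: exp_double exp_minus inverse_eq_divide)
    have "u\<^sup>2 * exp (- (2 * ln u + (-1) * v)) = exp v"
      using assms e by (simp add: exp_diff exp_minus field_simps)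
    moreover have "exp (2 * ln u + (-1) * v) = u\<^sup>2 * exp (- v)"
      using e by (simp add: exp_diff exp_minus field_simps)
    ultimately show ?thesis
      using assms by (simp add: bessel_kernel_def powr_def exp_add[symmetric] algebra_simps)
  qed
  then have "(\<integral>v. bessel_kernel a u v \<partial>lborel) = u powr (2 * a) * (\<integral>v. bessel_kernel (- a) u v \<partial>lborel)"
    by (subst lborel_integral_real_affine[where c="-1" and t="2 * ln u"]) auto
  then show ?thesis by (simp add: bessel_line_def)
qed

lemma borel_measurable_cosh [measurable]: "(cosh :: real \<Rightarrow> real) \<in> borel_measurable borel"
  by (intro borel_measurable_continuous_onI continuous_intros)

lemma bessel_kernel_shift:
  assumes "0 < u"
  shows "bessel_kernel a u (ln u + z) = u powr a * (exp (- u * cosh z) * exp (a * z))"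
  using assms by (simp add: bessel_kernel_def cosh_field_def powr_def exp_add[symmetric] algebra_simps)
    (simp add: exp_add exp_diff exp_minus power2_eq_square field_simps)

lemma bessel_integrand_integrable:
  fixes a u :: real
  assumes "0 < u"
  shows "integrable lborel (\<lambda>z. exp (- u * cosh z) * exp (a * z))"
proof -
  have "integrable lborel (\<lambda>z. bessel_kernel a u (ln u + 1 * z))"
    using bessel_kernel_integrable[of u a] assms
    by (subst lborel_integrable_real_affine_iff) auto
  then show ?thesis using assms by (simp add: bessel_kernel_shift)
qed

lemma bessel_line_eq:
  assumes "0 < u"
  shows "bessel_line a u = u powr a * ((\<integral>z. exp (- u * cosh z) * exp (a * z) \<partial>lborel) / 2)"
proof -
  have "(\<integral>v. bessel_kernel a u v \<partial>lborel) = u powr a * (\<integral>z. exp (- u * cosh z) * exp (a * z) \<partial>lborel)"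
    by (subst lborel_integral_real_affine[where c=1 and t="ln u"]) (use assms in \<open>auto simp: bessel_kernel_shift\<close>)
  then show ?thesis by (simp add: bessel_line_def)
qed

lemma bessel_cosh_integrable:
  fixes a u :: real
  assumes "0 < u"
  shows "integrable lborel (\<lambda>z. exp (- u * cosh z) * cosh (a * z))"
proof -
  have "integrable lborel (\<lambda>z. (exp (- u * cosh z) * exp (a * z) + exp (- u * cosh z) * exp ((- a) * z)) / 2)"
    by (intro integrable_divide Bochner_Integration.integrable_add bessel_integrand_integrable assms)
  then show ?thesis by (simp add: cosh_field_def field_simps)
qed

lemma bessel_K_eq_line_integral:
  assumes "0 < u"
  shows "bessel_K a u = (\<integral>z. exp (- u * cosh z) * cosh (a * z) \<partial>lborel) / 2"
proof -
  let ?h = "\<lambda>z. exp (- u * cosh z) * cosh (a * z)"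
  define k where "k z = indicator {0..} z * ?h z" for z :: real
  have k: "integrable lborel k"
    using integrable_mult_indicator[OF _ bessel_cosh_integrable[OF assms, of a], of "{0..}"]
    by (simp add: k_def[abs_def])
  then have k': "integrable lborel (\<lambda>z. k (0 + (-1) * z))"
    by (subst lborel_integrable_real_affine_iff) auto
  have "(\<integral>z. ?h z \<partial>lborel) = (\<integral>z. k z + k (0 + (-1) * z) \<partial>lborel)"
  proof (rule integral_cong_AE)
    \<comment> \<open>The two half-lines overlap at 0, a null set.\<close>
    show "AE z in lborel. ?h z = k z + k (0 + (-1) * z)"
      using AE_lborel_singleton[of 0] by eventually_elim (auto simp: k_def indicator_def)
    show "(\<lambda>z. k z + k (0 + (-1) * z)) \<in> borel_measurable lborel"
      using k k' by measurable
  qed measurable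
  also have "\<dots> = (\<integral>z. k z \<partial>lborel) + (\<integral>z. k (0 + (-1) * z) \<partial>lborel)"
    using k k' by (rule Bochner_Integration.integral_add)
  also have "(\<integral>z. k (0 + (-1) * z) \<partial>lborel) = (\<integral>z. k z \<partial>lborel)"
    by (subst (2) lborel_integral_real_affine[where c="-1" and t=0]) auto
  also have "(\<integral>z. k z \<partial>lborel) = bessel_K a u"
    by (simp add: bessel_K_def set_lebesgue_integral_def k_def)
  finally show ?thesis by simp
qed

text \<open>The weight exp (- u * cosh z) is even, so only the even part cosh (a * z) of exp (a * z)
  contributes.\<close>

lemma bessel_line_eq_bessel_K:
  assumes "0 < u"
  shows "bessel_line a u = u powr a * bessel_K a u"
proof -
  let ?f = "\<lambda>a z. exp (- u * cosh z) * exp (a * z)"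
  have "(\<integral>z. ?f (- a) z \<partial>lborel) = (\<integral>z. ?f a z \<partial>lborel)"
    by (subst lborel_integral_real_affine[where c="-1" and t=0]) auto
  then have "(\<integral>z. ?f a z \<partial>lborel) = (\<integral>z. ?f a z + ?f (- a) z \<partial>lborel) / 2"
    using bessel_integrand_integrable[OF assms, of a] bessel_integrand_integrable[OF assms, of "- a"]
    by (subst Bochner_Integration.integral_add) auto
  also have "\<dots> = (\<integral>z. (?f a z + ?f (- a) z) / 2 \<partial>lborel)" by simp
  also have "\<dots> = (\<integral>z. exp (- u * cosh z) * cosh (a * z) \<partial>lborel)"
    by (intro Bochner_Integration.integral_cong) (auto simp: cosh_field_def field_simps)
  finally show ?thesis
    using assms by (simp add: bessel_line_eq bessel_K_eq_line_integral)
qed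

lemma bessel_K_mono:
  assumes "0 < u" "0 \<le> a" "a \<le> b"
  shows "bessel_K a u \<le> bessel_K b u"
proof -
  have "cosh (a * z) \<le> cosh (b * z)" for z
  proof -
    have "\<bar>a * z\<bar> \<le> \<bar>b * z\<bar>" using assms by (simp add: abs_mult mult_right_mono)
    then have "cosh \<bar>a * z\<bar> \<le> cosh \<bar>b * z\<bar>" by (subst cosh_real_nonneg_le_iff) auto
    then show ?thesis by (simp only: cosh_real_abs)
  qed
  then show ?thesis
    unfolding bessel_K_eq_line_integral[OF assms(1)]
    by (intro divide_right_mono integral_mono bessel_cosh_integrable assms mult_left_mono) auto
qed

text \<open>
  The quotient of \<open>K\<^sub>1\<close> and \<open>K\<^sub>0\<close> is the mean of \<open>cosh\<close> under the weight \<open>exp (- u * cosh z)\<close>, which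
  decreases in \<open>u\<close> by Chebyshev's association inequality.
\<close>

lemma bessel_K_ratio:
  assumes "0 < u0"
  obtains M where "0 < M" "\<And>u. u0 \<le> u \<Longrightarrow> bessel_K 1 u \<le> M * bessel_K 0 u"
proof -
  have Kpos: "0 < bessel_K a u0" for a
    using bessel_line_pos[of u0 a] assms by (simp add: bessel_line_eq_bessel_K zero_less_mult_iff)
  define M where "M = bessel_K 1 u0 / bessel_K 0 u0"
  have M: "0 < M" using Kpos by (simp add: M_def)
  have diff: "(\<integral>z. exp (- u * cosh z) * (cosh z - M) \<partial>lborel) = 2 * (bessel_K 1 u - M * bessel_K 0 u)"
    and int: "integrable lborel (\<lambda>z. exp (- u * cosh z) * (cosh z - M))" if "0 < u" for u
  proof -
    have i: "integrable lborel (\<lambda>z. exp (- u * cosh z) * cosh z)" "integrable lborel (\<lambda>z. exp (- u * cosh z))"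
      using bessel_cosh_integrable[OF that, of 1] bessel_cosh_integrable[OF that, of 0] by simp_all
    then have "integrable lborel (\<lambda>z. exp (- u * cosh z) * cosh z - M * exp (- u * cosh z))"
      by (intro Bochner_Integration.integrable_diff integrable_mult_right)
    then show "integrable lborel (\<lambda>z. exp (- u * cosh z) * (cosh z - M))"
      by (simp add: algebra_simps)
    have "(\<integral>z. exp (- u * cosh z) * (cosh z - M) \<partial>lborel)
       = (\<integral>z. exp (- u * cosh z) * cosh z - M * exp (- u * cosh z) \<partial>lborel)"
      by (simp add: algebra_simps)
    also have "\<dots> = (\<integral>z. exp (- u * cosh z) * cosh z \<partial>lborel) - M * (\<integral>z. exp (- u * cosh z) \<partial>lborel)"
      using i by simp
    finally show "(\<integral>z. exp (- u * cosh z) * (cosh z - M) \<partial>lborel) = 2 * (bessel_K 1 u - M * bessel_K 0 u)"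
      using that by (simp add: bessel_K_eq_line_integral)
  qed
  show ?thesis
  proof (rule that[OF M])
    fix u assume u: "u0 \<le> u"
    \<comment> \<open>Chebyshev's inequality pointwise: cosh z - M and the increment of the
      decreasing function exp (- (u - u0) * c) from c = M to c = cosh z have opposite signs. As M is
      the quotient at u0, the right-hand side integrates to 0.\<close>
    have "exp (- u * cosh z) * (cosh z - M) \<le> exp (- (u - u0) * M) * (exp (- u0 * cosh z) * (cosh z - M))" for z
    proof -
      have "(cosh z - M) * (exp (- (u - u0) * cosh z) - exp (- (u - u0) * M)) \<le> 0"
      proof (cases "cosh z \<le> M")
        case True
        then have "(u - u0) * cosh z \<le> (u - u0) * M" using u by (intro mult_left_mono) auto
        then show ?thesis using True by (intro mult_nonpos_nonneg) (auto simp: algebra_simps)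
      next
        case False
        then have "(u - u0) * M \<le> (u - u0) * cosh z" using u by (intro mult_left_mono) auto
        then show ?thesis using False by (intro mult_nonneg_nonpos) (auto simp: algebra_simps)
      qed
      then have "exp (- u0 * cosh z) * ((cosh z - M) * (exp (- (u - u0) * cosh z) - exp (- (u - u0) * M))) \<le> 0"
        by (rule mult_nonneg_nonpos[OF exp_ge_zero])
      moreover have "exp (- u * cosh z) = exp (- u0 * cosh z) * exp (- (u - u0) * cosh z)"
        by (simp add: exp_add[symmetric] algebra_simps)
      ultimately show ?thesis by (simp add: algebra_simps)
    qed
    then have "(\<integral>z. exp (- u * cosh z) * (cosh z - M) \<partial>lborel)
        \<le> (\<integral>z. exp (- (u - u0) * M) * (exp (- u0 * cosh z) * (cosh z - M)) \<partial>lborel)"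
      using u assms by (intro integral_mono integrable_mult_right int) auto
    also have "\<dots> = exp (- (u - u0) * M) * (2 * (bessel_K 1 u0 - M * bessel_K 0 u0))"
      using assms by (simp only: integral_mult_right_zero diff)
    also have "\<dots> = 0" using Kpos[of 0] by (simp add: M_def)
    finally show "bessel_K 1 u \<le> M * bessel_K 0 u" using u assms diff[of u] by simp
  qed
qed

section \<open>The profile and its slope\<close>

definition y_profile :: "real \<Rightarrow> real \<Rightarrow> real" where
  "y_profile m s = C0 m * gam m powr (1 / (2 * gam m)) * bessel_line (1 / (2 * gam m)) (s / gam m)"

text \<open>Differentiation lowers the order to \<nu> - 1, which is negative for m \<ge> 0, so that
  the Bessel integral is singular at 0; \<open>y_slope_eq\<close> isolates the singularity.\<close>

definition y_slope :: "real \<Rightarrow> real \<Rightarrow> real" where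
  "y_slope m s = - (C0 m * gam m powr (1 / (2 * gam m)) *
     (s / gam m * bessel_line (1 / (2 * gam m) - 1) (s / gam m)) / gam m)"

context
  fixes m \<gamma> \<nu> :: real
  assumes m: "0 \<le> m"
  defines "\<gamma> \<equiv> gam m" and "\<nu> \<equiv> 1 / (2 * gam m)"
begin

lemma gam_ge_1: "1 \<le> \<gamma>"
  using m by (simp add: \<gamma>_def gam_def)

lemma nu_bounds: "0 < \<nu>" "\<nu> \<le> 1 / 2"
  using m by (simp_all add: \<nu>_def gam_def field_simps)

lemma C0_pos: "0 < C0 m"
  using nu_bounds gam_ge_1 unfolding C0_def \<nu>_def[symmetric] \<gamma>_def[symmetric]
  by (intro divide_pos_pos mult_pos_pos Gamma_real_pos) auto

lemma y_const_pos: "0 < C0 m * gam m powr (1 / (2 * gam m))"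
  using C0_pos gam_ge_1 by (simp add: \<gamma>_def)

text \<open>With z = l powr (1 / \<gamma>) * t one has z powr \<gamma> = l * t powr \<gamma>, and
  \<gamma> \<nu> = 1 / 2 makes the prefactor z powr (1 / 2) equal to (z powr \<gamma>) powr \<nu>.
  Thus l and t enter only through this product. For t > 0 the limit in \<open>ysol\<close> does not
  arise.\<close>

lemma ysol_eq_profile:
  assumes "0 < l" "0 < t"
  shows "ysol l m t = y_profile m (l * t powr \<gamma>)"
proof -
  have \<gamma>: "0 < \<gamma>" using gam_ge_1 by simp
  define z where "z = l powr (1 / \<gamma>) * t"
  have z: "0 < z" using assms by (simp add: z_def)
  have zg: "z powr \<gamma> = l * t powr \<gamma>"
    using assms \<gamma> by (simp add: z_def powr_mult powr_powr)
  define u where "u = l * t powr \<gamma> / \<gamma>"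
  have u: "0 < u" using assms \<gamma> by (simp add: u_def)
  have "z powr (1/2) = (z powr \<gamma>) powr \<nu>"
    using z \<gamma> by (simp add: powr_powr \<nu>_def \<gamma>_def)
  also have "\<dots> = (\<gamma> * u) powr \<nu>" using \<gamma> by (simp add: zg u_def)
  also have "\<dots> = \<gamma> powr \<nu> * u powr \<nu>" using \<gamma> u by (simp add: powr_mult)
  finally have half: "z powr (1/2) = \<gamma> powr \<nu> * u powr \<nu>" .
  have "ysol l m t = C0 m * z powr (1/2) * bessel_K \<nu> (1 / \<gamma> * z powr \<gamma>)"
    using assms by (simp add: ysol_def ysol_formula_def z_def \<gamma>_def \<nu>_def)
  also have "1 / \<gamma> * z powr \<gamma> = u" by (simp add: zg u_def)
  finally show ?thesis
    using u by (simp add: half y_profile_def bessel_line_eq_bessel_K u_def \<gamma>_def \<nu>_def)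
qed

lemma y_profile_pos: "0 < s \<Longrightarrow> 0 < y_profile m s"
  using gam_ge_1 y_const_pos unfolding y_profile_def
  by (intro mult_pos_pos[OF _ bessel_line_pos]) (auto simp: \<gamma>_def)

lemma y_profile_antimono: "0 \<le> s \<Longrightarrow> s \<le> s' \<Longrightarrow> y_profile m s' \<le> y_profile m s"
  using gam_ge_1 y_const_pos nu_bounds unfolding y_profile_def
  by (intro mult_left_mono bessel_line_antimono divide_right_mono) (auto simp: \<gamma>_def \<nu>_def)

lemma y_profile_deriv:
  assumes "0 < s"
  shows "(y_profile m has_real_derivative y_slope m s) (at s)"
proof -
  have u: "0 < s / \<gamma>" using assms gam_ge_1 by simp
  have "((\<lambda>s. bessel_line \<nu> (s / \<gamma>)) has_real_derivative
      - (s / \<gamma> * bessel_line (\<nu> - 1) (s / \<gamma>)) * (1 / \<gamma>)) (at s)"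
    by (rule DERIV_chain2[where f="bessel_line \<nu>" and g="\<lambda>s. s / \<gamma>" and x=s, OF bessel_line_deriv[OF u]]) (use gam_ge_1 in \<open>auto intro!: derivative_eq_intros\<close>)
  then have "((\<lambda>s. C0 m * \<gamma> powr \<nu> * bessel_line \<nu> (s / \<gamma>)) has_real_derivative
      C0 m * \<gamma> powr \<nu> * (- (s / \<gamma> * bessel_line (\<nu> - 1) (s / \<gamma>)) * (1 / \<gamma>))) (at s)"
    by (rule DERIV_cmult)
  then show ?thesis
    by (simp add: y_profile_def[abs_def] y_slope_def \<gamma>_def \<nu>_def)
qed

text \<open>Reflecting the order to 1 - \<nu> > 0 leaves a Bessel factor that is finite at 0; the
  whole singularity sits in the power of s.\<close>

lemma y_slope_eq:
  assumes "0 < s"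
  shows "y_slope m s = - (C0 m * \<gamma> powr \<nu> / \<gamma> * ((s / \<gamma>) powr (2 * \<nu> - 1) * bessel_line (1 - \<nu>) (s / \<gamma>)))"
proof -
  have u: "0 < s / \<gamma>" using assms gam_ge_1 by simp
  have "s / \<gamma> * bessel_line (\<nu> - 1) (s / \<gamma>) = (s / \<gamma>) powr 1 * (s / \<gamma>) powr (2 * (\<nu> - 1)) * bessel_line (1 - \<nu>) (s / \<gamma>)"
    using assms gam_ge_1 bessel_line_reflect[OF u, of "\<nu> - 1"] by simp
  also have "\<dots> = (s / \<gamma>) powr (2 * \<nu> - 1) * bessel_line (1 - \<nu>) (s / \<gamma>)"
    unfolding powr_add[symmetric] by (simp add: algebra_simps)
  finally show ?thesis by (simp add: y_slope_def \<gamma>_def \<nu>_def)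
qed

text \<open>The first bound freezes the Bessel factor of \<open>y_slope_eq\<close> at 0. For the
  second, slope and profile are, up to constants, u powr \<nu> times K of order 1 - \<nu> and of
  order \<nu>. Both orders lie between 0 and 1, so their quotient is at most that of orders 1 and 0,
  which \<open>bessel_K_ratio\<close> bounds for u \<ge> 1 / \<gamma>.\<close>

lemma y_slope_bound:
  obtains C where "0 < C" "\<And>s. 0 < s \<Longrightarrow> \<bar>y_slope m s\<bar> \<le> C * s powr (2 * \<nu> - 1)"
    "\<And>s. 1 \<le> s \<Longrightarrow> \<bar>y_slope m s\<bar> \<le> C * y_profile m s"
proof -
  have g: "0 < \<gamma>" using gam_ge_1 by simp
  define A where "A = C0 m * \<gamma> powr \<nu> / \<gamma>"
  have A: "0 < A" using C0_pos g by (simp add: A_def)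
  have slope: "\<bar>y_slope m s\<bar> = A * ((s / \<gamma>) powr (2 * \<nu> - 1) * bessel_line (1 - \<nu>) (s / \<gamma>))" if "0 < s" for s
    using y_slope_eq[OF that] A bessel_line_pos[of "s / \<gamma>" "1 - \<nu>"] that g
    by (simp add: A_def[symmetric] abs_mult)
  define C1 where "C1 = A * (1 / \<gamma>) powr (2 * \<nu> - 1) * bessel_line (1 - \<nu>) 0"
  have small: "\<bar>y_slope m s\<bar> \<le> C1 * s powr (2 * \<nu> - 1)" if "0 < s" for s
  proof -
    have "bessel_line (1 - \<nu>) (s / \<gamma>) \<le> bessel_line (1 - \<nu>) 0"
      using that g nu_bounds by (intro bessel_line_antimono) auto
    then have "\<bar>y_slope m s\<bar> \<le> A * ((s / \<gamma>) powr (2 * \<nu> - 1) * bessel_line (1 - \<nu>) 0)"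
      unfolding slope[OF that] using A by (intro mult_left_mono) auto
    also have "s / \<gamma> = 1 / \<gamma> * s" by simp
    also have "A * ((1 / \<gamma> * s) powr (2 * \<nu> - 1) * bessel_line (1 - \<nu>) 0) = C1 * s powr (2 * \<nu> - 1)"
      using that g by (simp add: C1_def powr_mult del: times_divide_eq_left)
    finally show ?thesis .
  qed
  obtain M where M: "0 < M" "\<And>u. 1 / \<gamma> \<le> u \<Longrightarrow> bessel_K 1 u \<le> M * bessel_K 0 u"
    using bessel_K_ratio[of "1 / \<gamma>"] g by auto
  have large: "\<bar>y_slope m s\<bar> \<le> M * y_profile m s" if s: "1 \<le> s" for s
  proof -
    define u where "u = s / \<gamma>"
    have u: "0 < u" "1 / \<gamma> \<le> u" using s g by (auto simp: u_def divide_right_mono)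
    have "bessel_K (1 - \<nu>) u \<le> bessel_K 1 u" using u nu_bounds by (intro bessel_K_mono) auto
    also have "\<dots> \<le> M * bessel_K 0 u" by (rule M(2)[OF u(2)])
    also have "\<dots> \<le> M * bessel_K \<nu> u" using u nu_bounds M by (intro mult_left_mono bessel_K_mono) auto
    finally have K: "bessel_K (1 - \<nu>) u \<le> M * bessel_K \<nu> u" .
    have K0: "0 \<le> bessel_K (1 - \<nu>) u"
      using bessel_line_pos[of u "1 - \<nu>"] u by (simp add: bessel_line_eq_bessel_K zero_less_mult_iff)
    have "u powr (2 * \<nu> - 1) * bessel_line (1 - \<nu>) u = u powr \<nu> * bessel_K (1 - \<nu>) u"
      using u by (simp add: bessel_line_eq_bessel_K powr_add[symmetric] mult.assoc[symmetric])
    then have "\<bar>y_slope m s\<bar> = A * (u powr \<nu> * bessel_K (1 - \<nu>) u)"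
      using slope[of s] s by (simp add: u_def)
    also have "\<dots> \<le> (C0 m * \<gamma> powr \<nu>) * (u powr \<nu> * bessel_K (1 - \<nu>) u)"
      using gam_ge_1 C0_pos K0 unfolding A_def by (intro mult_right_mono) (auto simp: divide_le_eq_1 field_simps)
    also have "\<dots> \<le> (C0 m * \<gamma> powr \<nu>) * (u powr \<nu> * (M * bessel_K \<nu> u))"
      using K C0_pos by (intro mult_left_mono) auto
    also have "\<dots> = M * y_profile m s"
      using u by (simp add: y_profile_def bessel_line_eq_bessel_K u_def \<gamma>_def \<nu>_def)
    finally show ?thesis .
  qed
  define C where "C = max C1 M"
  show ?thesis
  proof (rule that[of C])
    show "0 < C" using M by (simp add: C_def)
    show "\<bar>y_slope m s\<bar> \<le> C * s powr (2 * \<nu> - 1)" if "0 < s" for s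
      by (rule order_trans[OF small[OF that]]) (simp add: C_def mult_right_mono)
    show "\<bar>y_slope m s\<bar> \<le> C * y_profile m s" if "1 \<le> s" for s
      by (rule order_trans[OF large[OF that]])
        (use y_profile_pos[of s] that in \<open>simp add: C_def mult_right_mono\<close>)
  qed
qed

text \<open>Taking t = 1 and l = s in \<open>is_T0\<close> gives the decay for s \<ge> T0, since m /
  (4 \<gamma>) = 1 / 2 - \<nu>. Below T0 the profile is at most its value at 0, and exp (T0 /
  \<gamma>) makes up for exp (- (s / \<gamma>)).\<close>

lemma y_profile_decay:
  assumes "is_T0 m T0"
  obtains C where "0 < C" "\<And>s. 0 < s \<Longrightarrow> y_profile m s \<le> C * s powr (\<nu> - 1 / 2) * exp (- (s / \<gamma>))"
    "\<And>s. 0 < s \<Longrightarrow> y_profile m s \<le> C * exp (- (s / \<gamma>))"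
proof -
  have g: "0 < \<gamma>" using gam_ge_1 by simp
  obtain C where T0: "1 \<le> T0" and C: "1 < C"
    and bd: "\<And>l t. 0 < l \<Longrightarrow> 0 \<le> t \<Longrightarrow> T0 \<le> l * t powr gam m \<Longrightarrow>
        ysol l m t \<le> C * (l powr (1 / gam m) * t) powr (- (m / 4)) *
            exp (- (1 / gam m * (l powr (1 / gam m) * t) powr gam m))"
    using assms unfolding is_T0_def by blast
  have large: "y_profile m s \<le> C * s powr (\<nu> - 1 / 2) * exp (- (s / \<gamma>))" if s: "T0 \<le> s" for s
  proof -
    have s0: "0 < s" using s T0 by simp
    have "ysol s m 1 \<le> C * (s powr (1 / \<gamma>)) powr (- (m / 4)) * exp (- (1 / \<gamma> * (s powr (1 / \<gamma>)) powr \<gamma>))"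
      using bd[of s 1] s s0 by (simp add: \<gamma>_def)
    also have "ysol s m 1 = y_profile m s" using ysol_eq_profile[of s 1] s0 by simp
    also have "(s powr (1 / \<gamma>)) powr \<gamma> = s" using s0 g by (simp add: powr_powr)
    also have "(s powr (1 / \<gamma>)) powr (- (m / 4)) = s powr (\<nu> - 1 / 2)"
      unfolding powr_powr using m by (intro arg_cong[where f="\<lambda>x. s powr x"]) (simp add: \<gamma>_def \<nu>_def gam_def field_simps)
    finally show ?thesis by simp
  qed
  \<comment> \<open>The power of T0 makes up for s powr (\<nu> - 1 / 2), which is at least T0 powr
    (\<nu> - 1 / 2) when s < T0.\<close>
  define B where "B = y_profile m 0 * exp (T0 / \<gamma>) * T0 powr (1 / 2 - \<nu>)"
  have y0: "0 < y_profile m 0" using y_profile_pos[of 1] y_profile_antimono[of 0 1] by simp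
  have T0p: "1 \<le> T0 powr (1 / 2 - \<nu>)" using T0 nu_bounds by (intro ge_one_powr_ge_zero) auto
  have small: "y_profile m s \<le> y_profile m 0 * exp (T0 / \<gamma>) * exp (- (s / \<gamma>))" if "0 < s" "s < T0" for s
  proof -
    have "s / \<gamma> \<le> T0 / \<gamma>" using that g by (intro divide_right_mono) auto
    then have "y_profile m 0 * 1 \<le> y_profile m 0 * exp (T0 / \<gamma> + - (s / \<gamma>))" using y0 by (intro mult_left_mono) auto
    with y_profile_antimono[of 0 s] that show ?thesis by (simp add: exp_diff exp_minus divide_inverse mult.assoc)
  qed
  have B: "y_profile m 0 * exp (T0 / \<gamma>) \<le> B" "0 < B"
    using T0p y0 T0 by (auto simp: B_def)
  define D where "D = B + C"
  show ?thesis
  proof (rule that[of D])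
    show "0 < D" using B C by (simp add: D_def)
    fix s :: real assume s: "0 < s"
    show "y_profile m s \<le> D * s powr (\<nu> - 1 / 2) * exp (- (s / \<gamma>))"
    proof (cases "T0 \<le> s")
      case True
      have "C * s powr (\<nu> - 1 / 2) * exp (- (s / \<gamma>)) \<le> D * s powr (\<nu> - 1 / 2) * exp (- (s / \<gamma>))"
        using B by (intro mult_right_mono) (auto simp: D_def)
      with large[OF True] show ?thesis by simp
    next
      case False
      have "T0 powr (\<nu> - 1 / 2) \<le> s powr (\<nu> - 1 / 2)"
        using False s nu_bounds by (intro powr_mono2') auto
      then have "B * T0 powr (\<nu> - 1 / 2) \<le> D * s powr (\<nu> - 1 / 2)"
        using B C by (intro mult_mono) (auto simp: D_def)
      also have "B * T0 powr (\<nu> - 1 / 2) = y_profile m 0 * exp (T0 / \<gamma>) * (T0 powr (1 / 2 - \<nu>) * T0 powr (\<nu> - 1 / 2))"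
        by (simp add: B_def)
      also have "T0 powr (1 / 2 - \<nu>) * T0 powr (\<nu> - 1 / 2) = 1"
        using T0 by (simp add: powr_add[symmetric])
      finally have h: "y_profile m 0 * exp (T0 / \<gamma>) * exp (- (s / \<gamma>)) \<le> D * s powr (\<nu> - 1 / 2) * exp (- (s / \<gamma>))"
        by (intro mult_right_mono) auto
      show ?thesis by (rule order_trans[OF small h]) (use s False in auto)
    qed
    show "y_profile m s \<le> D * exp (- (s / \<gamma>))"
    proof (cases "T0 \<le> s")
      case True
      have "s powr (\<nu> - 1 / 2) \<le> s powr 0"
        using True T0 nu_bounds by (intro powr_mono) auto
      then have "C * s powr (\<nu> - 1 / 2) \<le> D * 1"
        using True T0 B C by (intro mult_mono) (auto simp: D_def)
      then have "C * s powr (\<nu> - 1 / 2) * exp (- (s / \<gamma>)) \<le> D * exp (- (s / \<gamma>))"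
        by (intro mult_right_mono) auto
      then show ?thesis by (rule order_trans[OF large[OF True]])
    next
      case False
      have h: "y_profile m 0 * exp (T0 / \<gamma>) * exp (- (s / \<gamma>)) \<le> D * exp (- (s / \<gamma>))"
        using B C by (intro mult_right_mono) (auto simp: D_def)
      show ?thesis by (rule order_trans[OF small h]) (use s False in auto)
    qed
  qed
qed

end

section \<open>Spherical averages of exponentials\<close>

lemma emeasure_lborel_scale:
  fixes c :: real
  assumes "c \<noteq> 0" "A \<in> sets borel"
  shows "emeasure lborel A = ennreal \<bar>c\<bar> * emeasure lborel {z. c * z \<in> A}"
proof -
  have "emeasure lborel A = emeasure (density (distr lborel borel (\<lambda>x. 0 + c * x)) (\<lambda>_. ennreal \<bar>c\<bar>)) A"
    using lborel_real_affine[OF assms(1), of 0] by simp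
  also have "\<dots> = ennreal \<bar>c\<bar> * emeasure (distr lborel borel (\<lambda>x. c * x)) A"
    using assms by (simp add: emeasure_density nn_integral_cmult_indicator)
  also have "emeasure (distr lborel borel (\<lambda>x. c * x)) A = emeasure lborel {z. c * z \<in> A}"
    using assms by (subst emeasure_distr) (auto simp: vimage_def)
  finally show ?thesis .
qed

interpretation lborel_product: product_sigma_finite "\<lambda>_::nat. lborel :: real measure"
  by standard

lemma measurable_scale_Rn [measurable]: "scale_Rn N c \<in> lebesgue_Rn N \<rightarrow>\<^sub>M lebesgue_Rn N"
  unfolding scale_Rn_def lebesgue_Rn_def by measurable

lemma measurable_inner_Rn [measurable]: "inner_Rn N x \<in> borel_measurable (lebesgue_Rn N)"
  unfolding inner_Rn_def lebesgue_Rn_def by measurable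

text \<open>A product measure is determined by boxes, and each of the N coordinates contributes a
  factor |c|. Negative c is included because c = -1 yields the antipodal symmetry of the
  sphere.\<close>

lemma lebesgue_Rn_scale:
  assumes "c \<noteq> 0"
  shows "scale_measure (ennreal (\<bar>c\<bar> ^ N)) (distr (lebesgue_Rn N) (lebesgue_Rn N) (scale_Rn N c))
    = lebesgue_Rn N" (is "?P = _")
  unfolding lebesgue_Rn_def[of N]
proof (rule lborel_product.PiM_eqI)
  fix A :: "nat \<Rightarrow> real set"
  assume A: "\<And>i. i \<in> {..<N} \<Longrightarrow> A i \<in> sets lborel"
  let ?L = "Pi\<^sub>M {..<N} (\<lambda>_. lborel :: real measure)"
  have s: "scale_Rn N c \<in> ?L \<rightarrow>\<^sub>M ?L"
    using measurable_scale_Rn[of N c] by (simp add: lebesgue_Rn_def)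
  have P: "Pi\<^sub>E {..<N} A \<in> sets ?L" using A by (intro sets_PiM_I_finite) auto
  have "emeasure (scale_measure (ennreal (\<bar>c\<bar> ^ N)) (distr ?L ?L (scale_Rn N c))) (Pi\<^sub>E {..<N} A)
     = ennreal (\<bar>c\<bar> ^ N) * emeasure ?L (scale_Rn N c -` Pi\<^sub>E {..<N} A \<inter> space ?L)"
    using s P by (simp add: emeasure_distr)
  also have "scale_Rn N c -` Pi\<^sub>E {..<N} A \<inter> space ?L = Pi\<^sub>E {..<N} (\<lambda>i. {z. c * z \<in> A i})"
  proof (rule set_eqI)
    fix y
    have e: "scale_Rn N c y \<in> extensional {..<N}" unfolding scale_Rn_def by simp
    have "y \<in> scale_Rn N c -` Pi\<^sub>E {..<N} A \<inter> space ?L \<longleftrightarrow>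
      (\<forall>i<N. scale_Rn N c y i \<in> A i) \<and> y \<in> extensional {..<N}"
      unfolding space_PiM using e by (auto simp: PiE_iff)
    also have "(\<forall>i<N. scale_Rn N c y i \<in> A i) \<longleftrightarrow> (\<forall>i<N. c * y i \<in> A i)"
      by (simp add: scale_Rn_def Ball_def)
    finally show "y \<in> scale_Rn N c -` Pi\<^sub>E {..<N} A \<inter> space ?L \<longleftrightarrow>
      y \<in> Pi\<^sub>E {..<N} (\<lambda>i. {z. c * z \<in> A i})"
      by (auto simp: PiE_iff)
  qed
  also have "emeasure ?L \<dots> = (\<Prod>i<N. emeasure lborel {z. c * z \<in> A i})"
  proof (rule lborel_product.emeasure_PiM)
    fix i assume i: "i \<in> {..<N}"
    have "(\<lambda>z. c * z) -` A i \<inter> space lborel \<in> sets lborel"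
      using A[OF i] by (intro measurable_sets[where A=borel]) auto
    then show "{z. c * z \<in> A i} \<in> sets lborel" by (simp add: vimage_def)
  qed simp
  also have "ennreal (\<bar>c\<bar> ^ N) = (\<Prod>i<N. ennreal \<bar>c\<bar>)" by (simp add: ennreal_power)
  also have "(\<Prod>i<N. ennreal \<bar>c\<bar>) * (\<Prod>i<N. emeasure lborel {z. c * z \<in> A i})
      = (\<Prod>i<N. emeasure lborel (A i))"
    unfolding prod.distrib[symmetric]
    by (intro prod.cong refl emeasure_lborel_scale[symmetric]) (use A assms in auto)
  finally show "emeasure (scale_measure (ennreal (\<bar>c\<bar> ^ N)) (distr ?L ?L (scale_Rn N c))) (Pi\<^sub>E {..<N} A)
     = (\<Prod>i<N. emeasure lborel (A i))" by (simp add: ennreal_power)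
qed simp_all

lemma nn_integral_lebesgue_Rn_scale:
  assumes [measurable]: "f \<in> borel_measurable (lebesgue_Rn N)" and "c \<noteq> 0"
  shows "(\<integral>\<^sup>+y. f y \<partial>lebesgue_Rn N)
    = ennreal (\<bar>c\<bar> ^ N) * (\<integral>\<^sup>+y. f (scale_Rn N c y) \<partial>lebesgue_Rn N)"
proof -
  have "(\<integral>\<^sup>+y. f y \<partial>lebesgue_Rn N) = (\<integral>\<^sup>+y. f y
     \<partial>scale_measure (ennreal (\<bar>c\<bar> ^ N)) (distr (lebesgue_Rn N) (lebesgue_Rn N) (scale_Rn N c)))"
    by (simp add: lebesgue_Rn_scale[OF assms(2)])
  also have "\<dots> = ennreal (\<bar>c\<bar> ^ N) * (\<integral>\<^sup>+y. f (scale_Rn N c y) \<partial>lebesgue_Rn N)"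
    by (simp add: nn_integral_scale_measure nn_integral_distr)
  finally show ?thesis .
qed

lemma measurable_direction [measurable]:
  "(\<lambda>x. scale_Rn N (1 / norm_Rn N x) x) \<in> lebesgue_Rn N \<rightarrow>\<^sub>M lebesgue_Rn N"
  by (rule scale_norm_measurable)

lemma space_surface_measure: "space (surface_measure N) = unit_sphere_Rn N"
  by (auto simp: surface_measure_def space_scale_measure space_restrict_space space_lebesgue_Rn unit_sphere_Rn_def)

lemma sets_surface_measure:
  "sets (surface_measure N) = sets (restrict_space (lebesgue_Rn N) (unit_sphere_Rn N))"
  by (simp add: surface_measure_def)

lemma direction_in_sphere:
  assumes "0 < norm_Rn N x"
  shows "scale_Rn N (1 / norm_Rn N x) x \<in> unit_sphere_Rn N"
  using assms by (simp add: unit_sphere_Rn_def norm_scale_Rn) (simp add: Rn_def scale_Rn_def)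

text \<open>Brings spherical integrals back to Lebesgue integrals over the punctured ball, where
  dilations can act.\<close>

lemma nn_integral_surface_measure:
  assumes [measurable]: "f \<in> borel_measurable (lebesgue_Rn N)"
  shows "(\<integral>\<^sup>+\<omega>. f \<omega> \<partial>surface_measure N)
    = of_nat N * (\<integral>\<^sup>+y. f (scale_Rn N (1 / norm_Rn N y) y) * indicator {y. 0 < norm_Rn N y \<and> norm_Rn N y \<le> 1} y \<partial>lebesgue_Rn N)"
proof -
  let ?L = "lebesgue_Rn N" and ?p = "\<lambda>x. scale_Rn N (1 / norm_Rn N x) x"
  let ?B = "{x \<in> Rn N. 0 < norm_Rn N x \<and> norm_Rn N x \<le> 1}"
  have "{x \<in> space ?L. 0 < norm_Rn N x \<and> norm_Rn N x \<le> 1} \<in> sets ?L" by measurable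
  then have B: "?B \<in> sets ?L" by (simp add: space_lebesgue_Rn)
  have p: "?p \<in> restrict_space ?L ?B \<rightarrow>\<^sub>M restrict_space ?L (unit_sphere_Rn N)"
    using direction_in_sphere by (intro measurable_restrict_space3[OF scale_norm_measurable]) blast
  have f: "f \<in> borel_measurable (restrict_space ?L (unit_sphere_Rn N))"
    by (intro measurable_restrict_space1) simp
  have "(\<integral>\<^sup>+\<omega>. f \<omega> \<partial>surface_measure N) = of_nat N * (\<integral>\<^sup>+y. f (?p y) \<partial>restrict_space ?L ?B)"
    unfolding surface_measure_def using p f
    by (subst nn_integral_scale_measure) (simp_all add: nn_integral_distr)
  also have "(\<integral>\<^sup>+y. f (?p y) \<partial>restrict_space ?L ?B) = (\<integral>\<^sup>+y. f (?p y) * indicator ?B y \<partial>?L)"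
    using B by (intro nn_integral_restrict_space) (simp add: Int_absorb2 sets.sets_into_space)
  also have "\<dots> = (\<integral>\<^sup>+y. f (?p y) * indicator {y. 0 < norm_Rn N y \<and> norm_Rn N y \<le> 1} y \<partial>?L)"
    by (intro nn_integral_cong) (auto simp: indicator_def space_lebesgue_Rn)
  finally show ?thesis .
qed

lemma inner_scale_Rn_right: "inner_Rn N x (scale_Rn N c y) = c * inner_Rn N x y"
  by (simp add: inner_Rn_def scale_Rn_def sum_distrib_left algebra_simps)

lemma inner_scale_Rn_left: "inner_Rn N (scale_Rn N c x) y = c * inner_Rn N x y"
  by (simp add: inner_Rn_def scale_Rn_def sum_distrib_left algebra_simps)

lemma abs_inner_Rn_le: "\<bar>inner_Rn N x y\<bar> \<le> norm_Rn N x * norm_Rn N y"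
proof -
  have "\<bar>inner_Rn N x y\<bar> \<le> (\<Sum>i<N. \<bar>x i\<bar> * \<bar>y i\<bar>)"
    unfolding inner_Rn_def by (rule order_trans[OF sum_abs]) (simp add: abs_mult)
  also have "\<dots> \<le> norm_Rn N x * norm_Rn N y"
    unfolding norm_Rn_def by (rule L2_set_mult_ineq)
  finally show ?thesis .
qed

lemma norm_Rn_nonneg [simp]: "0 \<le> norm_Rn N x"
  by (simp add: norm_Rn_def)

lemma scale_scale_Rn: "scale_Rn N a (scale_Rn N b x) = scale_Rn N (a * b) x"
  by (auto simp: scale_Rn_def fun_eq_iff)

text \<open>The integrand depends on the direction alone, so a dilation by r changes only the
  volume. This replaces the radial integration of polar coordinates.\<close>

lemma nn_integral_direction_ball:
  assumes [measurable]: "f \<in> borel_measurable (lebesgue_Rn N)" and r: "0 < r"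
  shows "(\<integral>\<^sup>+y. f (scale_Rn N (1 / norm_Rn N y) y) * indicator {y. 0 < norm_Rn N y \<and> norm_Rn N y \<le> r} y \<partial>lebesgue_Rn N)
    = ennreal (r ^ N) * (\<integral>\<^sup>+y. f (scale_Rn N (1 / norm_Rn N y) y) * indicator {y. 0 < norm_Rn N y \<and> norm_Rn N y \<le> 1} y \<partial>lebesgue_Rn N)"
proof -
  have "(\<integral>\<^sup>+y. f (scale_Rn N (1 / norm_Rn N y) y) * indicator {y. 0 < norm_Rn N y \<and> norm_Rn N y \<le> r} y \<partial>lebesgue_Rn N)
    = ennreal (\<bar>r\<bar> ^ N) * (\<integral>\<^sup>+y. f (scale_Rn N (1 / norm_Rn N (scale_Rn N r y)) (scale_Rn N r y)) * indicator {y. 0 < norm_Rn N y \<and> norm_Rn N y \<le> r} (scale_Rn N r y) \<partial>lebesgue_Rn N)"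
    by (rule nn_integral_lebesgue_Rn_scale) (use r in \<open>measurable, simp\<close>)
  also have "(\<integral>\<^sup>+y. f (scale_Rn N (1 / norm_Rn N (scale_Rn N r y)) (scale_Rn N r y)) * indicator {y. 0 < norm_Rn N y \<and> norm_Rn N y \<le> r} (scale_Rn N r y) \<partial>lebesgue_Rn N)
     = (\<integral>\<^sup>+y. f (scale_Rn N (1 / norm_Rn N y) y) * indicator {y. 0 < norm_Rn N y \<and> norm_Rn N y \<le> 1} y \<partial>lebesgue_Rn N)"
    using r by (intro nn_integral_cong) (auto simp: indicator_def norm_scale_Rn scale_scale_Rn zero_less_mult_iff)
  finally show ?thesis using r by simp
qed

lemma nn_integral_surface_reflect:
  assumes [measurable]: "f \<in> borel_measurable (lebesgue_Rn N)"
  shows "(\<integral>\<^sup>+\<omega>. f (scale_Rn N (-1) \<omega>) \<partial>surface_measure N) = (\<integral>\<^sup>+\<omega>. f \<omega> \<partial>surface_measure N)"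
proof -
  have m: "(\<lambda>y. f (scale_Rn N (1 / norm_Rn N y) y) * indicator {y. 0 < norm_Rn N y \<and> norm_Rn N y \<le> 1} y)
      \<in> borel_measurable (lebesgue_Rn N)" by measurable
  have "(\<integral>\<^sup>+y. f (scale_Rn N (1 / norm_Rn N y) y) * indicator {y. 0 < norm_Rn N y \<and> norm_Rn N y \<le> 1} y \<partial>lebesgue_Rn N)
     = ennreal (\<bar>-1\<bar> ^ N) * (\<integral>\<^sup>+y. f (scale_Rn N (1 / norm_Rn N (scale_Rn N (-1) y)) (scale_Rn N (-1) y)) * indicator {y. 0 < norm_Rn N y \<and> norm_Rn N y \<le> 1} (scale_Rn N (-1) y) \<partial>lebesgue_Rn N)"
    by (rule nn_integral_lebesgue_Rn_scale[OF m]) simp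
  also have "\<dots> = (\<integral>\<^sup>+y. f (scale_Rn N (-1) (scale_Rn N (1 / norm_Rn N y) y)) * indicator {y. 0 < norm_Rn N y \<and> norm_Rn N y \<le> 1} y \<partial>lebesgue_Rn N)"
    by (simp add: norm_scale_Rn scale_scale_Rn indicator_def)
  finally show ?thesis
    by (simp add: nn_integral_surface_measure)
qed

lemma emeasure_ball_Rn_finite: "emeasure (lebesgue_Rn N) {y \<in> Rn N. 0 < norm_Rn N y \<and> norm_Rn N y \<le> 1} < \<infinity>"
proof -
  let ?Q = "Pi\<^sub>E {..<N} (\<lambda>_. {-1..1::real})"
  have *: "\<bar>y i\<bar> \<le> norm_Rn N y" if "i < N" for y :: "nat \<Rightarrow> real" and i
    using member_le_L2_set[of "{..<N}" i "\<lambda>i. \<bar>y i\<bar>"] that by (simp add: norm_Rn_def L2_set_def)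
  have sub: "{y \<in> Rn N. 0 < norm_Rn N y \<and> norm_Rn N y \<le> 1} \<subseteq> ?Q"
  proof
    fix y assume y: "y \<in> {y \<in> Rn N. 0 < norm_Rn N y \<and> norm_Rn N y \<le> 1}"
    then have "y i \<in> {-1..1}" if "i < N" for i
      using *[OF that, of y] by auto
    with y show "y \<in> ?Q" by (simp add: Rn_def PiE_iff)
  qed
  have Q: "?Q \<in> sets (lebesgue_Rn N)"
    unfolding lebesgue_Rn_def by (intro sets_PiM_I_finite) auto
  have "emeasure (lebesgue_Rn N) ?Q = (\<Prod>i<N. emeasure lborel {-1..1::real})"
    unfolding lebesgue_Rn_def by (intro lborel_product.emeasure_PiM) auto
  also have "\<dots> < \<infinity>" by (simp add: power_less_top_ennreal)
  finally show ?thesis using emeasure_mono[OF sub Q] by simp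
qed

lemma emeasure_ball_Rn_pos:
  assumes "1 \<le> N"
  shows "0 < emeasure (lebesgue_Rn N) {y \<in> Rn N. 0 < norm_Rn N y \<and> norm_Rn N y \<le> 1}"
proof -
  \<comment> \<open>A box of positive volume in the punctured ball: coordinates at most 1 / N have
    sum, hence norm, at most 1, and positive coordinates keep it away from the origin.\<close>
  let ?Q = "Pi\<^sub>E {..<N} (\<lambda>_. {1 / (2 * real N)..1 / real N})"
  have sub: "?Q \<subseteq> {y \<in> space (lebesgue_Rn N). 0 < norm_Rn N y \<and> norm_Rn N y \<le> 1}"
  proof (intro subsetI CollectI conjI)
    fix y assume y: "y \<in> ?Q"
    then show "y \<in> space (lebesgue_Rn N)" by (auto simp: space_lebesgue_Rn Rn_def PiE_iff)
    have b: "1 / (2 * real N) \<le> y i" "y i \<le> 1 / real N" if "i < N" for i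
      using y that by (auto simp: PiE_iff)
    have pos: "0 < y i" if "i < N" for i
      using b(1)[OF that] assms by (meson less_le_trans zero_less_divide_1_iff mult_pos_pos of_nat_0_less_iff less_le_trans zero_less_numeral zero_less_one)
    show "0 < norm_Rn N y"
    proof -
      have "0 < y 0" using pos assms by simp
      also have "y 0 \<le> norm_Rn N y"
        using member_le_L2_set[of "{..<N}" 0 y] assms pos[of 0] by (simp add: norm_Rn_def)
      finally show ?thesis .
    qed
    have "norm_Rn N y \<le> (\<Sum>i<N. y i)"
      unfolding norm_Rn_def using pos by (intro L2_set_le_sum) (simp add: less_imp_le)
    also have "\<dots> \<le> (\<Sum>i<N. 1 / real N)" using b by (intro sum_mono) simp
    also have "\<dots> = 1" using assms by simp
    finally show "norm_Rn N y \<le> 1" .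
  qed
  have "(0::ennreal) < ennreal (1 / (2 * real N)) ^ N" 
    using assms by (subst ennreal_power) (auto simp: zero_less_power)
  also have "\<dots> = (\<Prod>i<N. emeasure lborel {1 / (2 * real N)..1 / real N})"
    using assms by (simp add: field_simps)
  also have "\<dots> = emeasure (lebesgue_Rn N) ?Q"
    unfolding lebesgue_Rn_def by (intro lborel_product.emeasure_PiM[symmetric]) auto
  also have "\<dots> \<le> emeasure (lebesgue_Rn N) {y \<in> space (lebesgue_Rn N). 0 < norm_Rn N y \<and> norm_Rn N y \<le> 1}"
    by (rule emeasure_mono[OF sub]) measurable
  finally show ?thesis by (simp add: space_lebesgue_Rn)
qed

lemma emeasure_unit_sphere:
  "emeasure (surface_measure N) (unit_sphere_Rn N)
    = of_nat N * emeasure (lebesgue_Rn N) {y \<in> Rn N. 0 < norm_Rn N y \<and> norm_Rn N y \<le> 1}"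
proof -
  have "emeasure (surface_measure N) (unit_sphere_Rn N) = (\<integral>\<^sup>+\<omega>. 1 \<partial>surface_measure N)"
    by (simp add: space_surface_measure)
  also have "\<dots> = of_nat N * (\<integral>\<^sup>+y. indicator {y \<in> space (lebesgue_Rn N). 0 < norm_Rn N y \<and> norm_Rn N y \<le> 1} y \<partial>lebesgue_Rn N)"
    by (subst nn_integral_surface_measure)
      (auto intro!: arg_cong2[where f="(*)"] nn_integral_cong simp: indicator_def simp del: nn_integral_indicator)
  also have "(\<integral>\<^sup>+y. indicator {y \<in> space (lebesgue_Rn N). 0 < norm_Rn N y \<and> norm_Rn N y \<le> 1} y \<partial>lebesgue_Rn N)
     = emeasure (lebesgue_Rn N) {y \<in> space (lebesgue_Rn N). 0 < norm_Rn N y \<and> norm_Rn N y \<le> 1}"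
    by (rule nn_integral_indicator) measurable
  finally show ?thesis by (simp add: space_lebesgue_Rn)
qed

lemma finite_measure_surface_measure: "finite_measure (surface_measure N)"
  by (standard) (use emeasure_ball_Rn_finite[of N] in \<open>auto simp: space_surface_measure emeasure_unit_sphere ennreal_mult_eq_top_iff\<close>)

lemma measure_unit_sphere_pos:
  assumes "1 \<le> N"
  shows "0 < measure (surface_measure N) (unit_sphere_Rn N)"
proof -
  interpret finite_measure "surface_measure N" by (rule finite_measure_surface_measure)
  have "0 < emeasure (surface_measure N) (unit_sphere_Rn N)"
    using emeasure_ball_Rn_pos[OF assms] assms by (simp add: emeasure_unit_sphere ennreal_zero_less_mult_iff)
  then show ?thesis by (simp add: emeasure_eq_measure)
qed

text \<open>The integrand factors over the coordinates, and the shift of s by a completes the square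
  in each factor. The one-dimensional mass is kept as a symbol; its finiteness suffices
  later.\<close>

lemma nn_integral_gaussian_Rn:
  "(\<integral>\<^sup>+y. exp (inner_Rn N x y - (norm_Rn N y)\<^sup>2 / 2) \<partial>lebesgue_Rn N)
    = ennreal (exp ((norm_Rn N x)\<^sup>2 / 2)) * (\<integral>\<^sup>+s. exp (- s\<^sup>2 / 2) \<partial>lborel) ^ N"
proof -
  have sq: "(norm_Rn N y)\<^sup>2 = (\<Sum>i<N. (y i)\<^sup>2)" for y
    by (simp add: norm_Rn_def L2_set_def sum_nonneg)
  have one: "(\<integral>\<^sup>+s. exp (a * s - s\<^sup>2 / 2) \<partial>lborel) = ennreal (exp (a\<^sup>2 / 2)) * (\<integral>\<^sup>+s. exp (- s\<^sup>2 / 2) \<partial>lborel)" for a :: real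
  proof -
    have "(\<integral>\<^sup>+s. exp (a * s - s\<^sup>2 / 2) \<partial>lborel) = (\<integral>\<^sup>+s. exp (a * (a + 1 * s) - (a + 1 * s)\<^sup>2 / 2) \<partial>lborel)"
      by (subst nn_integral_real_affine[where c=1 and t=a]) auto
    also have "\<dots> = (\<integral>\<^sup>+s. ennreal (exp (a\<^sup>2 / 2)) * exp (- s\<^sup>2 / 2) \<partial>lborel)"
      by (intro nn_integral_cong)
        (simp add: ennreal_mult[symmetric] exp_add[symmetric] power2_eq_square field_simps)
    also have "\<dots> = ennreal (exp (a\<^sup>2 / 2)) * (\<integral>\<^sup>+s. exp (- s\<^sup>2 / 2) \<partial>lborel)"
      by (rule nn_integral_cmult) simp
    finally show ?thesis .
  qed
  have "(\<integral>\<^sup>+y. exp (inner_Rn N x y - (norm_Rn N y)\<^sup>2 / 2) \<partial>lebesgue_Rn N)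
    = (\<integral>\<^sup>+y. (\<Prod>i<N. ennreal (exp (x i * y i - (y i)\<^sup>2 / 2))) \<partial>lebesgue_Rn N)"
    by (intro nn_integral_cong)
      (simp add: inner_Rn_def sq prod_ennreal exp_sum[symmetric] sum_subtractf sum_divide_distrib)
  also have "\<dots> = (\<Prod>i<N. \<integral>\<^sup>+s. exp (x i * s - s\<^sup>2 / 2) \<partial>lborel)"
    unfolding lebesgue_Rn_def by (rule lborel_product.product_nn_integral_prod) auto
  also have "\<dots> = ennreal (exp ((norm_Rn N x)\<^sup>2 / 2)) * (\<integral>\<^sup>+s. exp (- s\<^sup>2 / 2) \<partial>lborel) ^ N"
    by (simp add: one prod.distrib sq sum_divide_distrib exp_sum prod_ennreal)
  finally show ?thesis .
qed

lemma nn_integral_gaussian_finite: "(\<integral>\<^sup>+s. exp (- s\<^sup>2 / 2) \<partial>lborel) < \<infinity>"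
proof -
  have "exp (- s\<^sup>2 / 2) \<le> exp (1/2) * exp (- 1 * \<bar>s\<bar>)" for s :: real
    \<comment> \<open>Expanding (|s| - 1)^2 \<ge> 0 gives - s^2 / 2 \<le> 1 / 2 - |s|.\<close>
    using zero_le_power2[of "\<bar>s\<bar> - 1"]
    by (simp add: exp_add[symmetric] power2_eq_square algebra_simps)
  then have "(\<integral>\<^sup>+s. exp (- s\<^sup>2 / 2) \<partial>lborel) \<le> (\<integral>\<^sup>+s. ennreal (exp (1/2) * exp (- 1 * \<bar>s\<bar>)) \<partial>lborel)"
    by (intro nn_integral_mono ennreal_leI) simp
  also have "\<dots> < \<infinity>"
  proof -
    have "integrable lborel (\<lambda>s::real. exp (1/2) * exp (- 1 * \<bar>s\<bar>))"
      using integrable_exp_neg_abs[of 1] by (intro integrable_mult_right) simp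
    then show ?thesis unfolding integrable_iff_bounded by simp
  qed
  finally show ?thesis .
qed

section \<open>Bounds for the spherical average \<open>phi\<close>\<close>

lemma surface_nn_integral_bound:
  assumes "\<And>\<omega>. \<omega> \<in> unit_sphere_Rn N \<Longrightarrow> f \<omega> \<le> c"
  shows "(\<integral>\<^sup>+\<omega>. ennreal (f \<omega>) \<partial>surface_measure N) \<le> ennreal c * ennreal (measure (surface_measure N) (unit_sphere_Rn N))"
proof -
  interpret finite_measure "surface_measure N" by (rule finite_measure_surface_measure)
  have "(\<integral>\<^sup>+\<omega>. ennreal (f \<omega>) \<partial>surface_measure N) \<le> (\<integral>\<^sup>+\<omega>. ennreal c \<partial>surface_measure N)"
    by (intro nn_integral_mono ennreal_leI assms) (simp add: space_surface_measure)
  then show ?thesis by (simp add: space_surface_measure emeasure_eq_measure)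
qed

text \<open>Passes from the Bochner integral in \<open>phi\<close> to a nonnegative integral, to
  which the scaling lemmas apply. The Cauchy-Schwarz bound on the exponent makes it finite.\<close>

lemma nn_integral_exp_eq_phi:
  assumes "2 \<le> N"
  shows "(\<integral>\<^sup>+\<omega>. exp (inner_Rn N x \<omega>) \<partial>surface_measure N)
    = ennreal (phi N x) * ennreal (measure (surface_measure N) (unit_sphere_Rn N))"
proof -
  let ?S = "measure (surface_measure N) (unit_sphere_Rn N)"
  have S: "0 < ?S" using assms by (intro measure_unit_sphere_pos) simp
  have "(\<integral>\<^sup>+\<omega>. exp (inner_Rn N x \<omega>) \<partial>surface_measure N) \<le> ennreal (exp (norm_Rn N x)) * ennreal ?S"
  proof (rule surface_nn_integral_bound)
    fix \<omega> assume "\<omega> \<in> unit_sphere_Rn N"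
    then show "exp (inner_Rn N x \<omega>) \<le> exp (norm_Rn N x)"
      using abs_inner_Rn_le[of N x \<omega>] by (simp add: unit_sphere_Rn_def)
  qed
  also have "\<dots> < \<infinity>" by (simp add: ennreal_mult_less_top)
  finally have fin: "(\<integral>\<^sup>+\<omega>. exp (inner_Rn N x \<omega>) \<partial>surface_measure N) < \<infinity>" .
  have m: "(\<lambda>\<omega>. exp (inner_Rn N x \<omega>)) \<in> borel_measurable (surface_measure N)"
  proof -
    have "(\<lambda>\<omega>. exp (inner_Rn N x \<omega>)) \<in> borel_measurable (restrict_space (lebesgue_Rn N) (unit_sphere_Rn N))"
      by (intro measurable_restrict_space1) measurable
    then show ?thesis by (simp add: measurable_cong_sets[OF sets_surface_measure refl])
  qed
  have "(LINT \<omega>|surface_measure N. exp (inner_Rn N x \<omega>)) = enn2real (\<integral>\<^sup>+\<omega>. exp (inner_Rn N x \<omega>) \<partial>surface_measure N)"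
    using m by (intro integral_eq_nn_integral) auto
  then have "phi N x * ?S = enn2real (\<integral>\<^sup>+\<omega>. exp (inner_Rn N x \<omega>) \<partial>surface_measure N)"
    using S assms by (simp add: phi_def)
  then have "ennreal (phi N x * ?S) = (\<integral>\<^sup>+\<omega>. exp (inner_Rn N x \<omega>) \<partial>surface_measure N)"
    using fin by simp
  then show ?thesis using S by (simp add: ennreal_mult'')
qed

lemma phi_le_exp:
  assumes "1 \<le> N"
  shows "phi N x \<le> exp (norm_Rn N x)"
proof (cases "N = 1")
  case True
  have "exp (x 0) \<le> exp \<bar>x 0\<bar>" "exp (- x 0) \<le> exp \<bar>x 0\<bar>" by simp_all
  from add_mono[OF this] have "(exp (x 0) + exp (- x 0)) / 2 \<le> exp \<bar>x 0\<bar>" by simp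
  with True show ?thesis by (simp add: phi_def norm_Rn_def L2_set_def)
next
  case False
  let ?S = "measure (surface_measure N) (unit_sphere_Rn N)"
  have N: "2 \<le> N" and S: "0 < ?S" using assms False by (auto intro: measure_unit_sphere_pos)
  have "(\<integral>\<^sup>+\<omega>. exp (inner_Rn N x \<omega>) \<partial>surface_measure N) \<le> ennreal (exp (norm_Rn N x)) * ennreal ?S"
  proof (rule surface_nn_integral_bound)
    fix \<omega> assume "\<omega> \<in> unit_sphere_Rn N"
    then show "exp (inner_Rn N x \<omega>) \<le> exp (norm_Rn N x)"
      using abs_inner_Rn_le[of N x \<omega>] by (simp add: unit_sphere_Rn_def)
  qed
  then have "ennreal (phi N x * ?S) \<le> ennreal (exp (norm_Rn N x) * ?S)"
    unfolding nn_integral_exp_eq_phi[OF N] using S by (simp add: ennreal_mult'')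
  then show ?thesis using S by (simp add: ennreal_le_iff)
qed

text \<open>Integrate exp s + exp (- s) \<ge> 2 over the sphere with s the inner product of x and
  the direction; by antipodal symmetry both terms have the same integral.\<close>

lemma phi_ge_1:
  assumes "1 \<le> N"
  shows "1 \<le> phi N x"
proof (cases "N = 1")
  case True
  then show ?thesis using cosh_real_ge_1[of "x 0"] by (simp add: phi_def cosh_field_def)
next
  case False
  let ?S = "measure (surface_measure N) (unit_sphere_Rn N)"
  interpret finite_measure "surface_measure N" by (rule finite_measure_surface_measure)
  have N: "2 \<le> N" and S: "0 < ?S" using assms False by (auto intro: measure_unit_sphere_pos)
  have m: "(\<lambda>\<omega>. ennreal (exp (c * inner_Rn N x \<omega>))) \<in> borel_measurable (surface_measure N)" for c
  proof -
    have "(\<lambda>\<omega>. ennreal (exp (c * inner_Rn N x \<omega>))) \<in> borel_measurable (restrict_space (lebesgue_Rn N) (unit_sphere_Rn N))"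
      by (intro measurable_restrict_space1) measurable
    then show ?thesis by (simp add: measurable_cong_sets[OF sets_surface_measure refl])
  qed
  have "ennreal 2 * ennreal ?S = (\<integral>\<^sup>+\<omega>. ennreal 2 \<partial>surface_measure N)"
    by (simp add: space_surface_measure emeasure_eq_measure)
  also have "\<dots> \<le> (\<integral>\<^sup>+\<omega>. ennreal (exp (1 * inner_Rn N x \<omega>)) + ennreal (exp (-1 * inner_Rn N x \<omega>)) \<partial>surface_measure N)"
  proof (rule nn_integral_mono)
    fix \<omega>
    have "2 \<le> exp (inner_Rn N x \<omega>) + exp (- inner_Rn N x \<omega>)"
      using cosh_real_ge_1[of "inner_Rn N x \<omega>"] by (simp add: cosh_field_def)
    then show "ennreal 2 \<le> ennreal (exp (1 * inner_Rn N x \<omega>)) + ennreal (exp (-1 * inner_Rn N x \<omega>))"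
      by (simp del: ennreal_plus ennreal_numeral add: ennreal_plus[symmetric] ennreal_leI)
  qed
  also have "\<dots> = (\<integral>\<^sup>+\<omega>. ennreal (exp (1 * inner_Rn N x \<omega>)) \<partial>surface_measure N) + (\<integral>\<^sup>+\<omega>. ennreal (exp (-1 * inner_Rn N x \<omega>)) \<partial>surface_measure N)"
    by (intro nn_integral_add m)
  also have "(\<integral>\<^sup>+\<omega>. ennreal (exp (-1 * inner_Rn N x \<omega>)) \<partial>surface_measure N) = (\<integral>\<^sup>+\<omega>. ennreal (exp (inner_Rn N x \<omega>)) \<partial>surface_measure N)"
    using nn_integral_surface_reflect[of "\<lambda>\<omega>. ennreal (exp (inner_Rn N x \<omega>))" N]
    by (simp add: inner_scale_Rn_right)
  finally have le: "ennreal 2 * ennreal ?S \<le> ennreal (phi N x) * ennreal ?S + ennreal (phi N x) * ennreal ?S"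
    by (simp add: nn_integral_exp_eq_phi[OF N])
  have "0 \<le> phi N x" using N S by (simp add: phi_def)
  then have "ennreal (2 * ?S) \<le> ennreal (phi N x * ?S + phi N x * ?S)"
    using le S by (subst ennreal_plus) (simp_all add: ennreal_mult'' del: ennreal_numeral ennreal_plus)
  then have "2 * ?S \<le> phi N x * ?S + phi N x * ?S"
    using S \<open>0 \<le> phi N x\<close> by (subst (asm) ennreal_le_iff) auto
  then show ?thesis using S by (simp add: mult_le_cancel_right1[symmetric])
qed

text \<open>
  On the annulus \<open>R - 1 < |y| \<le> R\<close> with \<open>R = |z|\<close>, the value of \<open>exp (R z \<cdot> \<omega>)\<close> in the direction
  \<open>\<omega> = y / |y|\<close> is at most \<open>exp ((R\<^sup>2 + 1) / 2)\<close> times the shifted Gaussian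
  \<open>exp (z \<cdot> y - |y|\<^sup>2 / 2)\<close>, whose total mass is explicit.
\<close>

lemma phi_annulus_bound:
  assumes N: "2 \<le> N" and R: "2 \<le> norm_Rn N z"
  defines "R \<equiv> norm_Rn N z" and "S \<equiv> measure (surface_measure N) (unit_sphere_Rn N)"
    and "K \<equiv> enn2real (\<integral>\<^sup>+s. exp (- s\<^sup>2 / 2) \<partial>lborel)"
  shows "(R ^ N - (R - 1) ^ N) * (phi N (scale_Rn N R z) * S) \<le> real N * (exp (1/2) * exp (R\<^sup>2) * K ^ N)"
proof -
  let ?L = "lebesgue_Rn N"
  let ?d = "\<lambda>y. scale_Rn N (1 / norm_Rn N y) y"
  define f where "f = (\<lambda>\<omega>. ennreal (exp (inner_Rn N (scale_Rn N R z) \<omega>)))"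
  have [measurable]: "f \<in> borel_measurable ?L" unfolding f_def by measurable
  define I where "I r = (\<integral>\<^sup>+y. f (?d y) * indicator {y. 0 < norm_Rn N y \<and> norm_Rn N y \<le> r} y \<partial>?L)" for r
  define A where "A = (\<integral>\<^sup>+y. f (?d y) * indicator {y. R - 1 < norm_Rn N y \<and> norm_Rn N y \<le> R} y \<partial>?L)"
  have R': "2 \<le> R" using R by (simp add: R_def)
  have "S > 0" unfolding S_def using N by (intro measure_unit_sphere_pos) simp
  \<comment> \<open>Taking the annulus as a difference of two balls produces R^N - (R - 1)^N from
    scaling alone; R \<ge> 2 keeps the inner radius positive.\<close>
  have split: "I R = I (R - 1) + A"
    unfolding I_def A_def using R'
    by (subst nn_integral_add[symmetric]) (auto intro!: nn_integral_cong simp: indicator_def)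
  have ball: "I r = ennreal (r ^ N) * I 1" if "0 < r" for r
    unfolding I_def by (rule nn_integral_direction_ball) (use that in auto)
  have I1: "of_nat N * I 1 = ennreal (phi N (scale_Rn N R z) * S)"
  proof -
    have "of_nat N * I 1 = (\<integral>\<^sup>+\<omega>. f \<omega> \<partial>surface_measure N)"
      by (simp add: I_def nn_integral_surface_measure)
    also have "\<dots> = ennreal (phi N (scale_Rn N R z) * S)"
      using \<open>S > 0\<close> unfolding f_def nn_integral_exp_eq_phi[OF N] S_def by (simp add: ennreal_mult'')
    finally show ?thesis .
  qed
  have "A \<le> (\<integral>\<^sup>+y. ennreal (exp (1/2) * exp (R\<^sup>2 / 2)) * exp (inner_Rn N z y - (norm_Rn N y)\<^sup>2 / 2) \<partial>?L)"
    unfolding A_def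
  proof (rule nn_integral_mono)
    fix y
    show "f (?d y) * indicator {y. R - 1 < norm_Rn N y \<and> norm_Rn N y \<le> R} y
       \<le> ennreal (exp (1/2) * exp (R\<^sup>2 / 2)) * exp (inner_Rn N z y - (norm_Rn N y)\<^sup>2 / 2)"
    proof (cases "R - 1 < norm_Rn N y \<and> norm_Rn N y \<le> R")
      case True
      define q where "q = norm_Rn N y"
      define w where "w = inner_Rn N z (?d y)"
      have q: "R - 1 < q" "q \<le> R" using True by (auto simp: q_def)
      have "inner_Rn N z y = q * w"
        using q R' by (simp add: w_def inner_scale_Rn_right q_def)
      moreover have "w \<le> R"
        using abs_inner_Rn_le[of N z "?d y"] direction_in_sphere[of N y] q R'
        by (simp add: w_def R_def unit_sphere_Rn_def q_def)
      then have "(R - q) * w \<le> (R - q) * R" using q by (intro mult_left_mono) auto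
      moreover have "(R - q)\<^sup>2 \<le> 1" using q by (intro power_le_one) auto
      \<comment> \<open>Uses (R - q) * R = (R^2 - q^2) / 2 + (R - q)^2 / 2. The last term is at most
        1 / 2 because the annulus has width 1; this is the source of the factor exp (1/2).\<close>
      ultimately have "R * w \<le> 1/2 + R\<^sup>2 / 2 + (inner_Rn N z y - q\<^sup>2 / 2)"
        by (simp add: power2_eq_square algebra_simps)
      then have "exp (R * w) \<le> exp (1/2) * exp (R\<^sup>2 / 2) * exp (inner_Rn N z y - q\<^sup>2 / 2)"
        by (simp add: exp_add[symmetric])
      then show ?thesis
        using True by (simp add: f_def inner_scale_Rn_left w_def q_def ennreal_mult'[symmetric] ennreal_leI)
    qed simp
  qed
  also have "\<dots> = ennreal (exp (1/2) * exp (R\<^sup>2 / 2)) * (ennreal (exp (R\<^sup>2 / 2)) * (\<integral>\<^sup>+s. exp (- s\<^sup>2 / 2) \<partial>lborel) ^ N)"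
    by (subst nn_integral_cmult) (simp_all add: nn_integral_gaussian_Rn R_def)
  also have "(\<integral>\<^sup>+s. exp (- s\<^sup>2 / 2) \<partial>lborel) = ennreal K"
    unfolding K_def using nn_integral_gaussian_finite by simp
  also have "ennreal (exp (1/2) * exp (R\<^sup>2 / 2)) * (ennreal (exp (R\<^sup>2 / 2)) * ennreal K ^ N)
     = ennreal (exp (1/2) * exp (R\<^sup>2) * K ^ N)"
    by (simp add: K_def ennreal_mult'[symmetric] ennreal_power exp_add[symmetric])
  finally have A: "A \<le> ennreal (exp (1/2) * exp (R\<^sup>2) * K ^ N)" .
  have "ennreal (R ^ N * (phi N (scale_Rn N R z) * S)) = of_nat N * I R"
    using R' by (simp add: ennreal_mult' I1[symmetric] ball[of R] mult.left_commute)
  also have "\<dots> = of_nat N * I (R - 1) + of_nat N * A" by (simp add: split distrib_left)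
  also have "\<dots> \<le> of_nat N * I (R - 1) + of_nat N * ennreal (exp (1/2) * exp (R\<^sup>2) * K ^ N)"
    by (intro add_left_mono mult_left_mono A) simp
  also have "of_nat N * I (R - 1) = ennreal ((R - 1) ^ N * (phi N (scale_Rn N R z) * S))"
    using R' by (simp add: ennreal_mult' I1[symmetric] ball[of "R - 1"] mult.left_commute)
  also have "of_nat N * ennreal (exp (1/2) * exp (R\<^sup>2) * K ^ N) = ennreal (real N * (exp (1/2) * exp (R\<^sup>2) * K ^ N))"
    by (simp add: ennreal_mult' ennreal_of_nat_eq_real_of_nat)
  finally have "ennreal (R ^ N * (phi N (scale_Rn N R z) * S))
     \<le> ennreal ((R - 1) ^ N * (phi N (scale_Rn N R z) * S) + real N * (exp (1/2) * exp (R\<^sup>2) * K ^ N))"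
    using R' \<open>S > 0\<close> phi_ge_1[of N "scale_Rn N R z"] N by (subst ennreal_plus) (auto simp: K_def)
  then have "R ^ N * (phi N (scale_Rn N R z) * S)
     \<le> (R - 1) ^ N * (phi N (scale_Rn N R z) * S) + real N * (exp (1/2) * exp (R\<^sup>2) * K ^ N)"
    using R' \<open>S > 0\<close> phi_ge_1[of N "scale_Rn N R z"] N
    by (subst (asm) ennreal_le_iff) (auto simp: K_def intro!: add_nonneg_nonneg mult_nonneg_nonneg)
  then show ?thesis by (simp add: left_diff_distrib)
qed

text \<open>Write x = R z with R = |z| = sqrt |x|. The annulus has volume of order R^(N - 1), and
  this is |x| powr ((N - 1) / 2), the gain over the trivial bound exp |x|. For |x| < 4, that is R <
  2, the trivial bound suffices, with the constant 4 powr ((N - 1) / 2).\<close>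

lemma phi_bound:
  assumes N: "1 \<le> N"
  obtains C where "0 < C"
    "\<And>x. x \<in> Rn N \<Longrightarrow> 0 < norm_Rn N x \<Longrightarrow> phi N x \<le> C * norm_Rn N x powr (- ((real N - 1) / 2)) * exp (norm_Rn N x)"
proof (cases "N = 1")
  case True
  then show ?thesis using phi_le_exp[OF N] by (intro that[of 1]) auto
next
  case False
  with N have N2: "2 \<le> N" by simp
  define S where "S = measure (surface_measure N) (unit_sphere_Rn N)"
  define K where "K = enn2real (\<integral>\<^sup>+s. exp (- s\<^sup>2 / 2) \<partial>lborel)"
  have S: "0 < S" unfolding S_def using N by (rule measure_unit_sphere_pos)
  define C1 where "C1 = 2 ^ (N - 1) * exp (1/2) * K ^ N / S"
  define C where "C = C1 + 4 powr ((real N - 1) / 2)"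
  have C1: "0 \<le> C1" using S by (simp add: C1_def K_def)
  show ?thesis
  proof (rule that[of C])
    show "0 < C" unfolding C_def using C1 by (intro add_nonneg_pos) auto
    fix x assume x: "x \<in> Rn N" and pos: "0 < norm_Rn N x"
    define r where "r = norm_Rn N x"
    have r: "0 < r" using pos by (simp add: r_def)
    have "phi N x \<le> C * r powr (- ((real N - 1) / 2)) * exp r"
    proof (cases "r < 4")
      case True
      have "1 = r powr ((real N - 1) / 2) * r powr (- ((real N - 1) / 2))"
        using r by (simp add: powr_add[symmetric])
      also have "\<dots> \<le> 4 powr ((real N - 1) / 2) * r powr (- ((real N - 1) / 2))"
        using True r N by (intro mult_right_mono powr_mono2) auto
      also have "\<dots> \<le> C * r powr (- ((real N - 1) / 2))"
        using C1 by (intro mult_right_mono) (auto simp: C_def)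
      finally have "1 * exp r \<le> C * r powr (- ((real N - 1) / 2)) * exp r"
        by (intro mult_right_mono) auto
      then show ?thesis using order_trans[OF phi_le_exp[OF N, of x]] by (simp add: r_def)
    next
      case False
      define R where "R = sqrt r"
      have "sqrt 4 \<le> sqrt r" using False by (intro real_sqrt_le_mono) simp
      then have R: "2 \<le> R" by (simp add: R_def)
      have RR: "R * R = r" using r by (simp add: R_def)
      define z where "z = scale_Rn N (1 / R) x"
      have nz: "norm_Rn N z = R"
        using R RR by (simp add: z_def norm_scale_Rn r_def[symmetric] field_simps)
      have xz: "scale_Rn N R z = x"
        using R x by (auto simp: z_def scale_Rn_def fun_eq_iff Rn_def PiE_def extensional_def)
      have p: "0 \<le> phi N x" using phi_ge_1[OF N, of x] by simp
      \<comment> \<open>R \<ge> 2 means R / 2 \<le> R - 1, and each of the N summands in the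
        factorization of R^N - (R - 1)^N is at least (R - 1)^(N - 1).\<close>
      have "real N * (R / 2) ^ (N - 1) \<le> real N * (R - 1) ^ (N - 1)"
        using R by (intro mult_left_mono power_mono) auto
      also have "\<dots> \<le> R ^ N - (R - 1) ^ N"
      proof -
        have eq: "R ^ N - (R - 1) ^ N = (\<Sum>i<N. (R - 1) ^ (N - Suc i) * R ^ i)"
          using power_diff_sumr2[of R N "R - 1"] by simp
        have "(R - 1) ^ (N - 1) \<le> (R - 1) ^ (N - Suc i) * R ^ i" if "i < N" for i
        proof -
          have "(R - 1) ^ (N - 1) = (R - 1) ^ (N - Suc i) * (R - 1) ^ i"
            using that by (simp add: power_add[symmetric])
          also have "\<dots> \<le> (R - 1) ^ (N - Suc i) * R ^ i"
            using R by (intro mult_left_mono power_mono) auto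
          finally show ?thesis .
        qed
        then have "(\<Sum>i<N. (R - 1) ^ (N - 1)) \<le> (\<Sum>i<N. (R - 1) ^ (N - Suc i) * R ^ i)"
          by (intro sum_mono) auto
        then show ?thesis by (simp add: eq)
      qed
      finally have "real N * (R / 2) ^ (N - 1) * (phi N x * S) \<le> (R ^ N - (R - 1) ^ N) * (phi N x * S)"
        using p S by (intro mult_right_mono) auto
      also have "\<dots> \<le> real N * (exp (1/2) * exp (R\<^sup>2) * K ^ N)"
        using phi_annulus_bound[OF N2, of z] R by (simp add: nz xz S_def K_def)
      finally have "real N * ((R / 2) ^ (N - 1) * (phi N x * S)) \<le> real N * (exp (1/2) * exp (R\<^sup>2) * K ^ N)"
        by (simp add: mult.assoc)
      then have "(R / 2) ^ (N - 1) * (phi N x * S) \<le> exp (1/2) * exp r * K ^ N"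
        using N RR by (simp add: power2_eq_square)
      then have "phi N x \<le> C1 / R ^ (N - 1) * exp r"
        using S R by (simp add: C1_def field_simps)
      also have "R ^ (N - 1) = r powr ((real N - 1) / 2)"
      proof -
        have "R ^ (N - 1) = R powr (real N - 1)"
          using R N by (simp add: powr_realpow[symmetric] of_nat_diff)
        also have "\<dots> = r powr ((real N - 1) / 2)"
          unfolding R_def using r by (simp add: powr_half_sqrt[symmetric] powr_powr)
        finally show ?thesis .
      qed
      also have "C1 / r powr ((real N - 1) / 2) * exp r = C1 * r powr (- ((real N - 1) / 2)) * exp r"
        by (simp add: powr_minus field_simps)
      also have "\<dots> \<le> C * r powr (- ((real N - 1) / 2)) * exp r"
        by (intro mult_right_mono) (auto simp: C_def)
      finally show ?thesis .
    qed
    then show "phi N x \<le> C * norm_Rn N x powr (- ((real N - 1) / 2)) * exp (norm_Rn N x)"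
      by (simp add: r_def)
  qed
qed

lemma measurable_phi_scaled [measurable]: "(\<lambda>l. phi_scaled N l x) \<in> borel_measurable borel"
proof (cases "N = 1")
  case True
  then show ?thesis by (simp add: phi_scaled_def phi_def scale_Rn_def)
next
  case False
  interpret S: finite_measure "surface_measure N" by (rule finite_measure_surface_measure)
  have i: "inner_Rn N x \<in> borel_measurable (surface_measure N)"
  proof -
    have "inner_Rn N x \<in> borel_measurable (restrict_space (lebesgue_Rn N) (unit_sphere_Rn N))"
      by (intro measurable_restrict_space1) measurable
    then show ?thesis by (simp add: measurable_cong_sets[OF sets_surface_measure refl])
  qed
  have "(\<lambda>(l, \<omega>). exp (l * inner_Rn N x \<omega>)) \<in> borel_measurable (borel \<Otimes>\<^sub>M surface_measure N)"
    using i by measurable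
  then have "(\<lambda>l. LINT \<omega>|surface_measure N. exp (l * inner_Rn N x \<omega>)) \<in> borel_measurable borel"
    by (rule S.borel_measurable_lebesgue_integral)
  then show ?thesis using False by (simp add: phi_scaled_def phi_def inner_scale_Rn_left)
qed

lemma phi_scaled_ge_1: "1 \<le> N \<Longrightarrow> 1 \<le> phi_scaled N l x"
  by (simp add: phi_scaled_def phi_ge_1)

lemma phi_scaled_le_exp: "1 \<le> N \<Longrightarrow> 0 \<le> l \<Longrightarrow> phi_scaled N l x \<le> exp (l * norm_Rn N x)"
  using phi_le_exp[of N "scale_Rn N l x"] by (simp add: phi_scaled_def norm_scale_Rn)

lemma phi_scaled_bound:
  assumes "1 \<le> N"
  obtains C where "0 < C"
    "\<And>l x. 0 < l \<Longrightarrow> 0 < norm_Rn N x \<Longrightarrow>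
      phi_scaled N l x \<le> C * (l * norm_Rn N x) powr (- ((real N - 1) / 2)) * exp (l * norm_Rn N x)"
proof -
  obtain C where C: "0 < C"
    "\<And>x. x \<in> Rn N \<Longrightarrow> 0 < norm_Rn N x \<Longrightarrow> phi N x \<le> C * norm_Rn N x powr (- ((real N - 1) / 2)) * exp (norm_Rn N x)"
    using phi_bound[OF assms] by blast
  have "phi_scaled N l x \<le> C * (l * norm_Rn N x) powr (- ((real N - 1) / 2)) * exp (l * norm_Rn N x)"
    if "0 < l" "0 < norm_Rn N x" for l x
  proof -
    have "scale_Rn N l x \<in> Rn N" by (simp add: scale_Rn_def Rn_def)
    with C(2)[of "scale_Rn N l x"] that show ?thesis by (simp add: phi_scaled_def norm_scale_Rn)
  qed
  with C(1) show ?thesis by (rule that)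
qed

section \<open>Estimates of \<open>W\<close>\<close>

lemma has_bochner_integral_of_has_integral:
  fixes f :: "real \<Rightarrow> real"
  assumes [measurable]: "S \<in> sets borel" "f \<in> borel_measurable borel"
    and f: "\<And>x. x \<in> S \<Longrightarrow> 0 \<le> f x" "(f has_integral I) S"
  shows "has_bochner_integral lborel (\<lambda>x. indicator S x * f x) I"
proof (rule has_bochner_integral_nn_integral)
  show "0 \<le> I" using f by (rule has_integral_nonneg[rotated])
  show "(\<integral>\<^sup>+x. indicator S x * f x \<partial>lborel) = ennreal I"
    using nn_integral_has_integral_lebesgue[OF f] .
qed (use f in \<open>auto simp: indicator_def\<close>)

lemma integral_powr_from_0:
  fixes p b :: real
  assumes "0 < p" "0 \<le> b"
  shows "has_bochner_integral lborel (\<lambda>l. indicator {0..b} l * l powr (p - 1)) (b powr p / p)"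
  using has_bochner_integral_of_has_integral[OF _ _ _ has_integral_powr_from_0[of "p - 1" b]] assms by simp

definition mellin :: "(real \<Rightarrow> real) \<Rightarrow> real \<Rightarrow> real" where
  "mellin h p = (\<integral>s. indicator {0<..} s * (h s * s powr (p - 1)) \<partial>lborel)"

definition mellin_integrable :: "(real \<Rightarrow> real) \<Rightarrow> real \<Rightarrow> bool" where
  "mellin_integrable h p \<longleftrightarrow> integrable lborel (\<lambda>s. indicator {0<..} s * (h s * s powr (p - 1)))"

text \<open>The substitution s = \<sigma> * l. Here an integral over l becomes a power of the scale
  \<sigma> times a constant.\<close>

lemma mellin_scale:
  fixes h :: "real \<Rightarrow> real"
  assumes "mellin_integrable h p" and \<sigma>: "0 < \<sigma>"
  shows "has_bochner_integral lborel (\<lambda>l. indicator {0<..} l * (h (\<sigma> * l) * l powr (p - 1)))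
    (\<sigma> powr (- p) * mellin h p)"
proof -
  let ?g = "\<lambda>s. indicator {0<..} s * (h s * s powr (p - 1))"
  have eq: "indicator {0<..} l * (h (\<sigma> * l) * l powr (p - 1)) = \<sigma> powr (1 - p) * ?g (0 + \<sigma> * l)" for l
  proof (cases "0 < l")
    case True
    have "\<sigma> powr (1 - p) * (\<sigma> * l) powr (p - 1) = \<sigma> powr (1 - p + (p - 1)) * l powr (p - 1)"
      using \<sigma> True by (simp add: powr_mult powr_add[symmetric] mult.assoc[symmetric] del: add_diff_cancel)
    also have "\<dots> = l powr (p - 1)" using \<sigma> by simp
    finally show ?thesis using True \<sigma> by (simp add: indicator_def)
  next
    case False
    then show ?thesis using \<sigma> by (simp add: indicator_def zero_less_mult_iff)
  qed
  have int: "integrable lborel ?g" using assms(1) by (simp add: mellin_integrable_def)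
  have "integrable lborel (\<lambda>l. ?g (0 + \<sigma> * l))"
    using int \<sigma> by (subst lborel_integrable_real_affine_iff) auto
  moreover have "(\<integral>l. ?g (0 + \<sigma> * l) \<partial>lborel) = mellin h p / \<sigma>"
    using lborel_integral_real_affine[of \<sigma> ?g 0] \<sigma> by (simp add: mellin_def)
  ultimately have "has_bochner_integral lborel (\<lambda>l. \<sigma> powr (1 - p) * ?g (0 + \<sigma> * l)) (\<sigma> powr (1 - p) * (mellin h p / \<sigma>))"
    by (intro has_bochner_integral_mult_right) (simp add: has_bochner_integral_iff)
  also have "\<sigma> powr (1 - p) * (mellin h p / \<sigma>) = \<sigma> powr (- p) * mellin h p"
    using \<sigma> by (simp add: powr_diff powr_minus field_simps)
  finally show ?thesis unfolding eq .
qed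

lemma mellin_exp:
  assumes "0 < p"
  shows "mellin_integrable (\<lambda>s. exp (- s)) p"
proof -
  have "has_bochner_integral lborel (\<lambda>s. indicator {0..} s * (s powr (p - 1) / exp s)) (Gamma p)"
    by (rule has_bochner_integral_of_has_integral[OF _ _ _ Gamma_integral_real[OF assms]]) auto
  then have "integrable lborel (\<lambda>s. indicator {0..} s * (s powr (p - 1) / exp s))"
    by (simp add: has_bochner_integral_iff)
  then show ?thesis
    unfolding mellin_integrable_def
    by (rule Bochner_Integration.integrable_bound) (auto simp: indicator_def exp_minus field_simps)
qed

text \<open>The majorant for part 4 near the cone, where \<sigma> may be arbitrarily small and no
  exponential decay is left: bounded near 0, a power at infinity. Its Mellin transform converges at
  0 if p > 0 and at infinity if p + e < 0.\<close>

definition trunc_powr :: "real \<Rightarrow> real \<Rightarrow> real" where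
  "trunc_powr e s = (if s \<le> 1 then 1 else s powr e)"

lemma mellin_trunc_powr:
  assumes "0 < p" "p + e < 0"
  shows "mellin_integrable (trunc_powr e) p"
proof -
  have a: "integrable lborel (\<lambda>l. indicator {0..1} l * l powr (p - 1))"
    using integral_powr_from_0[of p 1] assms by (simp add: has_bochner_integral_iff)
  have "has_bochner_integral lborel (\<lambda>s. indicator {1..} s * s powr (e + p - 1)) (- (1 powr (e + p - 1 + 1)) / (e + p - 1 + 1))"
    by (rule has_bochner_integral_of_has_integral[OF _ _ _ has_integral_powr_to_inf]) (use assms in auto)
  then have b: "integrable lborel (\<lambda>s. indicator {1..} s * s powr (e + p - 1))"
    by (simp add: has_bochner_integral_iff)
  from Bochner_Integration.integrable_add[OF a b] show ?thesis
    unfolding mellin_integrable_def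
    by (rule Bochner_Integration.integrable_bound)
      (auto simp: indicator_def trunc_powr_def powr_add[symmetric] algebra_simps intro!: AE_I2)
qed

lemma mellin_nonneg: "(\<And>s. 0 \<le> h s) \<Longrightarrow> 0 \<le> mellin h p"
  unfolding mellin_def by (intro Bochner_Integration.integral_nonneg) auto

lemma bessel_line_measurable [measurable]: "bessel_line a \<in> borel_measurable borel"
proof -
  have "(\<lambda>(u, v). bessel_kernel a u v) \<in> borel_measurable (borel \<Otimes>\<^sub>M lborel)"
    unfolding bessel_kernel_def by measurable
  then have "(\<lambda>u. \<integral>v. bessel_kernel a u v \<partial>lborel) \<in> borel_measurable borel"
    by (rule lborel.borel_measurable_lebesgue_integral)
  then show ?thesis unfolding bessel_line_def[abs_def] by measurable
qed

lemma y_profile_measurable [measurable]: "y_profile m \<in> borel_measurable borel"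
  unfolding y_profile_def[abs_def] by measurable

section \<open>The density of \<open>W\<close>, its lower bound and its time derivative\<close>

context
  fixes m \<gamma> \<nu> :: real and N :: nat
  assumes m: "0 \<le> m" and N: "1 \<le> N"
  defines "\<gamma> \<equiv> gam m" and "\<nu> \<equiv> 1 / (2 * gam m)"
begin

lemma gam_nu_bounds: "1 \<le> \<gamma>" "0 < \<gamma>" "0 < \<nu>" "\<nu> \<le> 1 / 2"
  using m by (auto simp: \<gamma>_def \<nu>_def gam_def field_simps)

lemma gam_mult_nu: "\<gamma> * \<nu> = 1 / 2"
  using m by (simp add: \<gamma>_def \<nu>_def gam_def field_simps)

definition W_density :: "real \<Rightarrow> (nat \<Rightarrow> real) \<Rightarrow> real \<Rightarrow> real \<Rightarrow> real" where
  "W_density \<beta> x \<tau> l = indicator {0<..1} l * (y_profile m (l * \<tau>) * phi_scaled N l x * l powr (\<beta> - 1))"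

lemma Wfun_eq:
  assumes "0 < t"
  shows "Wfun N \<beta> m x t = (\<integral>l. W_density \<beta> x (t powr \<gamma>) l \<partial>lborel)"
  unfolding Wfun_def set_lebesgue_integral_def
  by (intro Bochner_Integration.integral_cong)
    (use assms m in \<open>auto simp: W_density_def ysol_eq_profile \<gamma>_def indicator_def\<close>)

lemma W_density_measurable [measurable]: "W_density \<beta> x \<tau> \<in> borel_measurable borel"
  unfolding W_density_def[abs_def] by measurable

lemma W_density_nonneg:
  assumes "0 < \<tau>"
  shows "0 \<le> W_density \<beta> x \<tau> l"
  using y_profile_pos[OF m, of "l * \<tau>"] phi_scaled_ge_1[OF N, of l x] assms
  by (auto simp: W_density_def indicator_def)

lemma phi_scaled_le_exp_norm:
  assumes "0 < l" "l \<le> 1"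
  shows "phi_scaled N l x \<le> exp (norm_Rn N x)"
proof -
  have "l * norm_Rn N x \<le> 1 * norm_Rn N x" using assms by (intro mult_right_mono) auto
  with phi_scaled_le_exp[OF N, of l x] assms show ?thesis by (auto intro: order_trans)
qed

lemma W_density_integrable:
  assumes "0 < \<beta>" "0 < \<tau>"
  shows "integrable lborel (W_density \<beta> x \<tau>)"
proof -
  have "integrable lborel (\<lambda>l. indicator {0..1} l * l powr (\<beta> - 1))"
    using integral_powr_from_0[of \<beta> 1] assms by (simp add: has_bochner_integral_iff)
  then have "integrable lborel (\<lambda>l. (y_profile m 0 * exp (norm_Rn N x)) * (indicator {0..1} l * l powr (\<beta> - 1)))"
    by (rule integrable_mult_right)
  then show ?thesis
  proof (rule Bochner_Integration.integrable_bound)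
    have "W_density \<beta> x \<tau> l \<le> (y_profile m 0 * exp (norm_Rn N x)) * (indicator {0..1} l * l powr (\<beta> - 1))" for l
    proof (cases "0 < l \<and> l \<le> 1")
      case True
      have y: "0 < y_profile m (l * \<tau>)" "y_profile m (l * \<tau>) \<le> y_profile m 0"
        using True assms y_profile_antimono[OF m, of 0 "l * \<tau>"] y_profile_pos[OF m, of "l * \<tau>"] by auto
      have "y_profile m (l * \<tau>) * phi_scaled N l x * l powr (\<beta> - 1) \<le> y_profile m 0 * exp (norm_Rn N x) * l powr (\<beta> - 1)"
        using y phi_scaled_le_exp_norm[of l x] phi_scaled_ge_1[OF N, of l x] True
        by (intro mult_right_mono mult_mono) auto
      then show ?thesis using True by (simp add: W_density_def)
    next
      case False
      have "0 < y_profile m 0" using y_profile_pos[OF m, of 1] y_profile_antimono[OF m, of 0 1] by simp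
      then show ?thesis using False by (auto simp: W_density_def indicator_def)
    qed
    then show "AE l in lborel. norm (W_density \<beta> x \<tau> l) \<le> norm ((y_profile m 0 * exp (norm_Rn N x)) * (indicator {0..1} l * l powr (\<beta> - 1)))"
      using W_density_nonneg[OF assms(2)] by (intro AE_I2) (auto intro: order_trans[OF _ abs_ge_self])
  qed measurable
qed

text \<open>Integration over (0, 1] is enlarged to the whole half-line, where scaling is exact. The
  profile \<open>h\<close> is later exp (- s) or \<open>trunc_powr\<close>.\<close>

lemma W_le_mellin:
  assumes "0 < \<beta>" "0 < \<tau>" "0 < \<sigma>" "0 \<le> K" "\<And>s. 0 \<le> h s" "mellin_integrable h p"
    and le: "\<And>l. 0 < l \<Longrightarrow> l \<le> 1 \<Longrightarrow>
      y_profile m (l * \<tau>) * phi_scaled N l x * l powr (\<beta> - 1) \<le> K * (h (\<sigma> * l) * l powr (p - 1))"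
  shows "(\<integral>l. W_density \<beta> x \<tau> l \<partial>lborel) \<le> K * (\<sigma> powr (- p) * mellin h p)"
proof -
  note M = mellin_scale[OF assms(6,3)]
  have "(\<integral>l. W_density \<beta> x \<tau> l \<partial>lborel) \<le> (\<integral>l. K * (indicator {0<..} l * (h (\<sigma> * l) * l powr (p - 1))) \<partial>lborel)"
  proof (rule integral_mono)
    show "integrable lborel (\<lambda>l. K * (indicator {0<..} l * (h (\<sigma> * l) * l powr (p - 1))))"
      using M by (intro integrable_mult_right) (simp add: has_bochner_integral_iff)
    show "W_density \<beta> x \<tau> l \<le> K * (indicator {0<..} l * (h (\<sigma> * l) * l powr (p - 1)))" for l
      using le[of l] assms by (auto simp: W_density_def indicator_def)
  qed (intro W_density_integrable assms)
  also have "\<dots> = K * (\<sigma> powr (- p) * mellin h p)"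
    using M by (simp add: has_bochner_integral_iff)
  finally show ?thesis .
qed

text \<open>Up to l = 1 / \<tau> the profile is at least its value at 1, and l powr (\<beta> - 1)
  integrates there to \<tau> powr (- \<beta>) / \<beta>. The constant is free of N.\<close>

lemma W_lower_bound:
  assumes \<beta>: "0 < \<beta>" and t: "1 < t"
  shows "y_profile m 1 / \<beta> * t powr (- (\<gamma> * \<beta>)) \<le> Wfun N \<beta> m x t"
proof -
  define \<tau> where "\<tau> = t powr \<gamma>"
  have \<tau>: "1 < \<tau>" unfolding \<tau>_def using t gam_nu_bounds by (intro gr_one_powr) auto
  have I: "has_bochner_integral lborel (\<lambda>l. indicator {0..1 / \<tau>} l * l powr (\<beta> - 1)) ((1 / \<tau>) powr \<beta> / \<beta>)"
    using \<tau> \<beta> by (intro integral_powr_from_0) auto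
  have y1: "0 < y_profile m 1" by (rule y_profile_pos[OF m]) simp
  have "y_profile m 1 * ((1 / \<tau>) powr \<beta> / \<beta>) = (\<integral>l. y_profile m 1 * (indicator {0..1 / \<tau>} l * l powr (\<beta> - 1)) \<partial>lborel)"
    using I by (simp add: has_bochner_integral_iff)
  also have "\<dots> \<le> (\<integral>l. W_density \<beta> x \<tau> l \<partial>lborel)"
  proof (rule integral_mono)
    show "integrable lborel (\<lambda>l. y_profile m 1 * (indicator {0..1 / \<tau>} l * l powr (\<beta> - 1)))"
      using I by (intro integrable_mult_right) (simp add: has_bochner_integral_iff)
    show "integrable lborel (W_density \<beta> x \<tau>)" using \<beta> \<tau> by (intro W_density_integrable) auto
    show "y_profile m 1 * (indicator {0..1 / \<tau>} l * l powr (\<beta> - 1)) \<le> W_density \<beta> x \<tau> l" for l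
    proof (cases "0 < l \<and> l \<le> 1 / \<tau>")
      case True
      then have l: "0 < l" "l * \<tau> \<le> 1" using \<tau> by (auto simp: field_simps)
      have "l \<le> 1" using True \<tau> by (meson divide_le_eq_1 less_imp_le order_trans zero_less_one less_trans)
      have "y_profile m 1 * 1 \<le> y_profile m (l * \<tau>) * phi_scaled N l x"
        using l \<tau> y1 y_profile_antimono[OF m, of "l * \<tau>" 1] phi_scaled_ge_1[OF N, of l x]
        by (intro mult_mono) auto
      then have "y_profile m 1 * 1 * l powr (\<beta> - 1) \<le> y_profile m (l * \<tau>) * phi_scaled N l x * l powr (\<beta> - 1)"
        by (intro mult_right_mono) auto
      then show ?thesis using True \<open>l \<le> 1\<close> by (simp add: W_density_def)
    next
      case False
      then show ?thesis using W_density_nonneg[of \<tau> \<beta> x l] \<tau> by (auto simp: indicator_def)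
    qed
  qed
  also have "\<dots> = Wfun N \<beta> m x t" using t by (simp add: Wfun_eq \<tau>_def)
  also have "(1 / \<tau>) powr \<beta> = t powr (- (\<gamma> * \<beta>))"
    using t by (simp add: \<tau>_def powr_divide powr_powr powr_minus_divide)
  finally show ?thesis by simp
qed

definition W_density_slope :: "real \<Rightarrow> (nat \<Rightarrow> real) \<Rightarrow> real \<Rightarrow> real \<Rightarrow> real" where
  "W_density_slope \<beta> x s l = indicator {0<..1} l *
    (y_slope m (l * s powr \<gamma>) * (l * (\<gamma> * s powr (\<gamma> - 1))) * phi_scaled N l x * l powr (\<beta> - 1))"

text \<open>The slope is singular at l = 0, but the chain rule supplies a factor l, and l * l powr
  (2 \<nu> - 1) = l powr (2 \<nu>) \<le> 1. With s > 1 and 2 \<nu> \<le> 1, the power of s powr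
  \<gamma> in the slope bound is at most 1, so one multiple of l powr (\<beta> - 1) dominates for
  all s in (1, t + 1).\<close>

lemma W_deriv:
  assumes \<beta>: "0 < \<beta>" and t: "1 < t"
    and C: "0 < C" "\<And>s. 0 < s \<Longrightarrow> \<bar>y_slope m s\<bar> \<le> C * s powr (2 * \<nu> - 1)"
  shows "((\<lambda>s. Wfun N \<beta> m x s) has_real_derivative (\<integral>l. W_density_slope \<beta> x t l \<partial>lborel)) (at t)"
    and "integrable lborel (W_density_slope \<beta> x t)"
proof -
  let ?F = "W_density_slope \<beta> x"
  define D where "D = C * (\<gamma> * (t + 1) powr (\<gamma> - 1)) * exp (norm_Rn N x)"
  have D: "0 \<le> D" using C gam_nu_bounds by (simp add: D_def)
  define g where "g l = D * (indicator {0..1} l * l powr (\<beta> - 1))" for l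
  have g: "integrable lborel g"
    unfolding g_def using integral_powr_from_0[of \<beta> 1] \<beta>
    by (intro integrable_mult_right) (simp add: has_bochner_integral_iff)
  have deriv: "((\<lambda>s. W_density \<beta> x (s powr \<gamma>) l) has_real_derivative ?F s l) (at s)" if s: "1 < s" for s l
  proof (cases "0 < l \<and> l \<le> 1")
    case True
    have "((\<lambda>s. l * s powr \<gamma>) has_real_derivative l * (\<gamma> * s powr (\<gamma> - 1))) (at s)"
      using s by (auto intro!: derivative_eq_intros simp: powr_diff)
    moreover have "(y_profile m has_real_derivative y_slope m (l * s powr \<gamma>)) (at (l * s powr \<gamma>))"
      by (rule y_profile_deriv[OF m]) (use True s in auto)
    ultimately have "((\<lambda>s. y_profile m (l * s powr \<gamma>)) has_real_derivative
        y_slope m (l * s powr \<gamma>) * (l * (\<gamma> * s powr (\<gamma> - 1)))) (at s)"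
      by (rule DERIV_chain2[where f="y_profile m" and g="\<lambda>s. l * s powr \<gamma>" and x=s, rotated])
    then have "((\<lambda>s. y_profile m (l * s powr \<gamma>) * (phi_scaled N l x * l powr (\<beta> - 1))) has_real_derivative
        y_slope m (l * s powr \<gamma>) * (l * (\<gamma> * s powr (\<gamma> - 1))) * (phi_scaled N l x * l powr (\<beta> - 1))) (at s)"
      by (rule DERIV_cmult_right)
    then show ?thesis using True by (simp add: W_density_def W_density_slope_def mult.assoc)
  next
    case False
    then show ?thesis by (auto simp: W_density_def W_density_slope_def indicator_def)
  qed
  have bound: "\<bar>?F s l\<bar> \<le> g l" if s: "1 < s" "s < t + 1" for s l
  proof (cases "0 < l \<and> l \<le> 1")
    case True
    have "1 \<le> s powr \<gamma>" using s gam_nu_bounds by (intro ge_one_powr_ge_zero) auto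
    then have "l * 1 \<le> l * s powr \<gamma>" using True by (intro mult_left_mono) auto
    then have "(l * s powr \<gamma>) powr (2 * \<nu> - 1) \<le> l powr (2 * \<nu> - 1)"
      using True gam_nu_bounds by (intro powr_mono2') auto
    then have "C * (l * s powr \<gamma>) powr (2 * \<nu> - 1) \<le> C * l powr (2 * \<nu> - 1)"
      using C by (intro mult_left_mono) auto
    with C(2)[of "l * s powr \<gamma>"] True s have y: "\<bar>y_slope m (l * s powr \<gamma>)\<bar> \<le> C * l powr (2 * \<nu> - 1)"
      by simp
    have "s powr (\<gamma> - 1) \<le> (t + 1) powr (\<gamma> - 1)" using s gam_nu_bounds by (intro powr_mono2) auto
    then have "l * (\<gamma> * s powr (\<gamma> - 1)) \<le> l * (\<gamma> * (t + 1) powr (\<gamma> - 1))"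
      using True gam_nu_bounds by (intro mult_left_mono) auto
    with y have "\<bar>y_slope m (l * s powr \<gamma>)\<bar> * (l * (\<gamma> * s powr (\<gamma> - 1))) * phi_scaled N l x
       \<le> C * l powr (2 * \<nu> - 1) * (l * (\<gamma> * (t + 1) powr (\<gamma> - 1))) * exp (norm_Rn N x)"
      using phi_scaled_le_exp_norm[of l x] phi_scaled_ge_1[OF N, of l x] True gam_nu_bounds C
      by (intro mult_mono) auto
    also have "\<dots> = D * (l powr (2 * \<nu> - 1) * l powr 1)" using True by (simp add: D_def)
    also have "l powr (2 * \<nu> - 1) * l powr 1 = l powr (2 * \<nu>)" unfolding powr_add[symmetric] by simp
    also have "D * l powr (2 * \<nu>) \<le> D * 1"
      using True gam_nu_bounds D by (intro mult_left_mono powr_le1) auto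
    finally have "\<bar>y_slope m (l * s powr \<gamma>)\<bar> * (l * (\<gamma> * s powr (\<gamma> - 1))) * phi_scaled N l x * l powr (\<beta> - 1)
       \<le> D * 1 * l powr (\<beta> - 1)" by (intro mult_right_mono) auto
    then show ?thesis
      using True gam_nu_bounds phi_scaled_ge_1[OF N, of l x] by (simp add: W_density_slope_def g_def abs_mult)
  next
    case False
    then show ?thesis using D by (auto simp: W_density_slope_def g_def indicator_def)
  qed
  have int: "integrable lborel (W_density \<beta> x (s powr \<gamma>))" if "1 < s" for s
    using that \<beta> by (intro W_density_integrable) auto
  note L = has_real_derivative_integral[of 1 t "t + 1" lborel "\<lambda>s. W_density \<beta> x (s powr \<gamma>)" ?F g]
  have "((\<lambda>s. \<integral>l. W_density \<beta> x (s powr \<gamma>) l \<partial>lborel) has_real_derivative (\<integral>l. ?F t l \<partial>lborel)) (at t)"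
    by (rule L(1)) (use t int deriv bound g in auto)
  then show "((\<lambda>s. Wfun N \<beta> m x s) has_real_derivative (\<integral>l. ?F t l \<partial>lborel)) (at t)"
    by (rule has_field_derivative_transform_within_open[where S="{0<..}"]) (use t in \<open>auto simp: Wfun_eq\<close>)
  show "integrable lborel (?F t)"
    by (rule L(2)) (use t int deriv bound g in auto)
qed

text \<open>Below l = 1 / \<tau> the exponential bound on \<open>phi_scaled\<close> is exp (|x| /
  \<tau>), and a pure power of l remains. Above it, slope is traded for profile, and the factor l
  from the chain rule turns the weight of \<beta> into that of \<beta> + 1. The summand 1 in
  \<open>K\<close> makes the constant exceed 1.\<close>

lemma W_deriv_bound:
  assumes \<beta>: "0 < \<beta>" and t: "1 < t" and C: "0 < C"
    and C1: "\<And>s. 0 < s \<Longrightarrow> \<bar>y_slope m s\<bar> \<le> C * s powr (2 * \<nu> - 1)"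
    and C2: "\<And>s. 1 \<le> s \<Longrightarrow> \<bar>y_slope m s\<bar> \<le> C * y_profile m s"
  defines "K \<equiv> C * \<gamma>\<^sup>2 + 1"
  shows "(\<lambda>s. Wfun N \<beta> m x s) differentiable (at t)"
    and "\<bar>deriv (\<lambda>s. Wfun N \<beta> m x s) t\<bar>
          \<le> K * exp (t powr (- \<gamma>) * norm_Rn N x) * t powr (- (\<gamma> * (\<beta> + 1 / \<gamma>)))
            + K * t powr (m / 2) * Wfun N (\<beta> + 1) m x t"
proof -
  define F where "F = W_density_slope \<beta> x"
  note D = W_deriv[OF \<beta> t C C1, of x, folded F_def]
  show "(\<lambda>s. Wfun N \<beta> m x s) differentiable (at t)"
    using D(1) unfolding real_differentiable_def by blast
  define \<tau> where "\<tau> = t powr \<gamma>"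
  have \<tau>: "1 < \<tau>" unfolding \<tau>_def using t gam_nu_bounds by (intro gr_one_powr) auto
  define E where "E = exp (norm_Rn N x / \<tau>)"
  define A where "A = C * \<gamma> * t powr (\<gamma> - 1)"
  have A: "0 \<le> A" using C gam_nu_bounds by (simp add: A_def)
  have p: "0 < 2 * \<nu> + \<beta>" using \<beta> gam_nu_bounds by simp
  note I = integral_powr_from_0[OF p, of "1 / \<tau>"]
  let ?h = "\<lambda>l. A * (E * \<tau> powr (2 * \<nu> - 1) * (indicator {0..1 / \<tau>} l * l powr (2 * \<nu> + \<beta> - 1))
      + W_density (\<beta> + 1) x \<tau> l)"
  have int: "integrable lborel (\<lambda>l. E * \<tau> powr (2 * \<nu> - 1) * (indicator {0..1 / \<tau>} l * l powr (2 * \<nu> + \<beta> - 1)))"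
    "integrable lborel (W_density (\<beta> + 1) x \<tau>)"
    using I \<tau> \<beta> by (auto intro!: W_density_integrable integrable_mult_right simp: has_bochner_integral_iff)
  have le: "\<bar>F t l\<bar> \<le> ?h l" for l
  proof (cases "0 < l \<and> l \<le> 1")
    case False
    then show ?thesis using A W_density_nonneg[of \<tau> "\<beta> + 1" x l] \<tau>
      by (auto simp: F_def W_density_slope_def indicator_def E_def)
  next
    case True
    have P: "1 \<le> phi_scaled N l x" by (rule phi_scaled_ge_1[OF N])
    have F: "\<bar>F t l\<bar> = \<bar>y_slope m (l * \<tau>)\<bar> * (\<gamma> * t powr (\<gamma> - 1)) * (phi_scaled N l x * l powr \<beta>)"
    proof -
      have "l powr \<beta> = l powr (1 + (\<beta> - 1))" by simp
      also have "\<dots> = l * l powr (\<beta> - 1)" unfolding powr_add using True by simp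
      finally show ?thesis using True gam_nu_bounds P by (simp add: F_def W_density_slope_def \<tau>_def abs_mult)
    qed
    show ?thesis
    proof (cases "l \<le> 1 / \<tau>")
      case small: True
      have "l * norm_Rn N x \<le> 1 / \<tau> * norm_Rn N x" using small by (intro mult_right_mono) auto
      then have "phi_scaled N l x \<le> E"
        using phi_scaled_le_exp[OF N, of l x] True by (auto simp: E_def intro: order_trans)
      then have "\<bar>F t l\<bar> \<le> (C * (l * \<tau>) powr (2 * \<nu> - 1)) * (\<gamma> * t powr (\<gamma> - 1)) * (E * l powr \<beta>)"
        unfolding F using True \<tau> gam_nu_bounds P C C1[of "l * \<tau>"] by (intro mult_mono) auto
      also have "\<dots> = A * (E * \<tau> powr (2 * \<nu> - 1) * (l powr (2 * \<nu> - 1) * l powr \<beta>))"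
        using True \<tau> by (simp add: A_def powr_mult)
      also have "l powr (2 * \<nu> - 1) * l powr \<beta> = l powr (2 * \<nu> + \<beta> - 1)"
        by (simp add: powr_add[symmetric] algebra_simps)
      also have "A * (E * \<tau> powr (2 * \<nu> - 1) * l powr (2 * \<nu> + \<beta> - 1)) \<le> ?h l"
        using small True A W_density_nonneg[of \<tau> "\<beta> + 1" x l] \<tau> by (intro mult_left_mono) auto
      finally show ?thesis .
    next
      case False
      then have "1 \<le> l * \<tau>" using \<tau> by (simp add: field_simps)
      then have "\<bar>F t l\<bar> \<le> (C * y_profile m (l * \<tau>)) * (\<gamma> * t powr (\<gamma> - 1)) * (phi_scaled N l x * l powr \<beta>)"
        unfolding F using gam_nu_bounds P C2[of "l * \<tau>"] by (intro mult_right_mono) auto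
      also have "\<dots> = ?h l" using True False by (simp add: A_def W_density_def)
      finally show ?thesis .
    qed
  qed
  have "\<bar>\<integral>l. F t l \<partial>lborel\<bar> \<le> (\<integral>l. \<bar>F t l\<bar> \<partial>lborel)"
    using integral_norm_bound[of lborel "F t"] by simp
  also have "\<dots> \<le> (\<integral>l. ?h l \<partial>lborel)"
    using D(2) int le by (intro integral_mono integrable_mult_right Bochner_Integration.integrable_add) auto
  also have "\<dots> = A * (E * (\<tau> powr (2 * \<nu> - 1) * ((1 / \<tau>) powr (2 * \<nu> + \<beta>) / (2 * \<nu> + \<beta>))) + Wfun N (\<beta> + 1) m x t)"
    using int I \<tau> t by (simp add: Wfun_eq \<tau>_def[symmetric] has_bochner_integral_iff)
  also have "\<tau> powr (2 * \<nu> - 1) * ((1 / \<tau>) powr (2 * \<nu> + \<beta>) / (2 * \<nu> + \<beta>)) = \<tau> powr (- 1 - \<beta>) / (2 * \<nu> + \<beta>)"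
  proof -
    have "(1 / \<tau>) powr (2 * \<nu> + \<beta>) = \<tau> powr (- (2 * \<nu> + \<beta>))"
      using \<tau> by (simp only: powr_divide powr_minus_divide powr_one_eq_one)
    then have "\<tau> powr (2 * \<nu> - 1) * (1 / \<tau>) powr (2 * \<nu> + \<beta>) = \<tau> powr ((2 * \<nu> - 1) + - (2 * \<nu> + \<beta>))"
      by (simp only: powr_add)
    then show ?thesis by simp
  qed
  finally have le1: "\<bar>\<integral>l. F t l \<partial>lborel\<bar> \<le> A * (E * (\<tau> powr (- 1 - \<beta>) / (2 * \<nu> + \<beta>)) + Wfun N (\<beta> + 1) m x t)" .
  \<comment> \<open>This removes the dependence on \<beta>: since 2 \<gamma> \<nu> = 1, the factor 1
    / (2 \<nu> + \<beta>) is at most \<gamma>. It accounts for the second \<gamma> in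
    \<open>K\<close>.\<close>
  have "\<gamma> * (2 * \<nu> + \<beta>) = 2 * (\<gamma> * \<nu>) + \<gamma> * \<beta>" by (simp add: algebra_simps)
  then have "1 \<le> \<gamma> * (2 * \<nu> + \<beta>)" using gam_mult_nu \<beta> gam_nu_bounds by simp
  then have "1 / (2 * \<nu> + \<beta>) \<le> \<gamma>" using p by (simp add: divide_le_eq)
  then have "\<tau> powr (- 1 - \<beta>) * (1 / (2 * \<nu> + \<beta>)) \<le> \<tau> powr (- 1 - \<beta>) * \<gamma>" by (intro mult_left_mono) auto
  then have "A * (E * (\<tau> powr (- 1 - \<beta>) / (2 * \<nu> + \<beta>))) \<le> A * (E * (\<tau> powr (- 1 - \<beta>) * \<gamma>))"
    using A by (intro mult_left_mono) (auto simp: E_def)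
  also have "\<dots> = C * \<gamma>\<^sup>2 * E * (t powr (\<gamma> - 1) * \<tau> powr (- 1 - \<beta>))" by (simp add: A_def power2_eq_square)
  also have "t powr (\<gamma> - 1) * \<tau> powr (- 1 - \<beta>) = t powr (- (\<gamma> * (\<beta> + 1 / \<gamma>)))"
    using gam_nu_bounds unfolding \<tau>_def powr_powr powr_add[symmetric] by (simp add: algebra_simps)
  also have "C * \<gamma>\<^sup>2 * E * t powr (- (\<gamma> * (\<beta> + 1 / \<gamma>))) \<le> K * E * t powr (- (\<gamma> * (\<beta> + 1 / \<gamma>)))"
    by (intro mult_right_mono) (auto simp: K_def E_def)
  finally have a: "A * (E * (\<tau> powr (- 1 - \<beta>) / (2 * \<nu> + \<beta>))) \<le> K * E * t powr (- (\<gamma> * (\<beta> + 1 / \<gamma>)))" .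
  have W: "0 \<le> Wfun N (\<beta> + 1) m x t"
    using t W_density_nonneg \<tau> by (auto simp: Wfun_eq \<tau>_def intro!: Bochner_Integration.integral_nonneg)
  have "C * \<gamma> * 1 \<le> C * \<gamma> * \<gamma>" using gam_nu_bounds C by (intro mult_left_mono) auto
  moreover have "\<gamma> - 1 = m / 2" by (simp add: \<gamma>_def gam_def add_divide_distrib)
  ultimately have "A \<le> K * t powr (m / 2)"
    unfolding A_def \<open>\<gamma> - 1 = m / 2\<close> by (intro mult_right_mono) (auto simp: K_def power2_eq_square)
  then have b: "A * Wfun N (\<beta> + 1) m x t \<le> K * t powr (m / 2) * Wfun N (\<beta> + 1) m x t"
    using W by (intro mult_right_mono)
  have "norm_Rn N x / \<tau> = t powr (- \<gamma>) * norm_Rn N x" by (simp add: \<tau>_def powr_minus_divide)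
  then have E: "E = exp (t powr (- \<gamma>) * norm_Rn N x)" by (simp add: E_def)
  have "\<bar>\<integral>l. F t l \<partial>lborel\<bar> \<le> K * E * t powr (- (\<gamma> * (\<beta> + 1 / \<gamma>))) + K * t powr (m / 2) * Wfun N (\<beta> + 1) m x t"
    using le1 a b by (simp add: distrib_left)
  then show "\<bar>deriv (\<lambda>s. Wfun N \<beta> m x s) t\<bar>
          \<le> K * exp (t powr (- \<gamma>) * norm_Rn N x) * t powr (- (\<gamma> * (\<beta> + 1 / \<gamma>)))
            + K * t powr (m / 2) * Wfun N (\<beta> + 1) m x t"
    by (simp only: DERIV_imp_deriv[OF D(1)] E)
qed

text \<open>As l \<le> 1, exp (r0 * l) \<le> exp r0. With A = |x|, the coefficient of - l then stays
  positive as long as |x| < r0 + \<tau> / \<gamma>.\<close>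

lemma exp_shift_bound:
  fixes l r0 \<tau> A :: real
  assumes "0 < l" "l \<le> 1" "0 < r0"
  shows "exp (- (l * \<tau> / \<gamma>)) * exp (l * A) \<le> exp r0 * exp (- ((r0 + \<tau> / \<gamma> - A) * l))"
proof -
  have "r0 * l \<le> r0 * 1" using assms by (intro mult_left_mono) auto
  then show ?thesis by (simp add: exp_add[symmetric] algebra_simps)
qed

section \<open>Upper bounds for \<open>W\<close> from the decay of the profile\<close>

context
  fixes D r0 :: real
  assumes D: "0 < D" "\<And>s. 0 < s \<Longrightarrow> y_profile m s \<le> D * s powr (\<nu> - 1 / 2) * exp (- (s / \<gamma>))"
      "\<And>s. 0 < s \<Longrightarrow> y_profile m s \<le> D * exp (- (s / \<gamma>))"
    and r0: "0 < r0"
begin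

lemma W_density_le_exp:
  assumes "0 < l" "l \<le> 1" "0 < \<tau>"
  shows "y_profile m (l * \<tau>) * phi_scaled N l x
    \<le> D * exp r0 * exp (- ((r0 + \<tau> / \<gamma> - norm_Rn N x) * l))"
proof -
  have "y_profile m (l * \<tau>) * phi_scaled N l x \<le> (D * exp (- (l * \<tau> / \<gamma>))) * exp (l * norm_Rn N x)"
    using assms D(1) D(3)[of "l * \<tau>"] phi_scaled_le_exp[OF N, of l x] phi_scaled_ge_1[OF N, of l x]
    by (intro mult_mono) auto
  also have "\<dots> = D * (exp (- (l * \<tau> / \<gamma>)) * exp (l * norm_Rn N x))" by simp
  also have "\<dots> \<le> D * (exp r0 * exp (- ((r0 + \<tau> / \<gamma> - norm_Rn N x) * l)))"
    using D(1) assms r0 by (intro mult_left_mono exp_shift_bound) auto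
  finally show ?thesis by (simp add: mult.assoc)
qed

lemma W_le_exp:
  assumes \<beta>: "0 < \<beta>" and \<tau>: "0 < \<tau>" and \<sigma>: "0 < r0 + \<tau> / \<gamma> - norm_Rn N x"
  shows "(\<integral>l. W_density \<beta> x \<tau> l \<partial>lborel)
    \<le> D * exp r0 * ((r0 + \<tau> / \<gamma> - norm_Rn N x) powr (- \<beta>) * mellin (\<lambda>s. exp (- s)) \<beta>)"
proof (rule W_le_mellin[OF \<beta> \<tau> \<sigma> _ _ mellin_exp[OF \<beta>]])
  show "y_profile m (l * \<tau>) * phi_scaled N l x * l powr (\<beta> - 1)
    \<le> D * exp r0 * (exp (- ((r0 + \<tau> / \<gamma> - norm_Rn N x) * l)) * l powr (\<beta> - 1))" if "0 < l" "l \<le> 1" for l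
    using mult_right_mono[OF W_density_le_exp[OF that \<tau>, of x], of "l powr (\<beta> - 1)"] by (simp add: mult.assoc)
qed (use D in auto)

text \<open>Where |x| is at least \<tau> / (2 \<gamma>), the decay of \<open>phi_scaled\<close> in l
  * |x| becomes decay in l * \<tau>. Its exponent - (N - 1) / 2 adds to \<nu> - 1 / 2 from the
  profile, giving \<nu> - N / 2.\<close>

lemma W_density_le_powr:
  assumes C: "0 < C" "\<And>l x. 0 < l \<Longrightarrow> 0 < norm_Rn N x \<Longrightarrow>
      phi_scaled N l x \<le> C * (l * norm_Rn N x) powr (- ((real N - 1) / 2)) * exp (l * norm_Rn N x)"
    and l: "0 < l" "l \<le> 1" and \<tau>: "0 < \<tau>" and x: "\<tau> / (2 * \<gamma>) \<le> norm_Rn N x"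
  shows "y_profile m (l * \<tau>) * phi_scaled N l x
    \<le> D * C * exp r0 * (2 * \<gamma>) powr ((real N - 1) / 2) *
      ((l * \<tau>) powr (\<nu> - real N / 2) * exp (- ((r0 + \<tau> / \<gamma> - norm_Rn N x) * l)))"
proof -
  define A where "A = norm_Rn N x"
  define q where "q = (real N - 1) / 2"
  have q: "0 \<le> q" using N by (simp add: q_def)
  have "0 < \<tau> / (2 * \<gamma>)" using \<tau> gam_nu_bounds by simp
  with x have A: "0 < A" by (simp add: A_def)
  have "l * \<tau> * (1 / (2 * \<gamma>)) \<le> l * A"
    using mult_left_mono[OF x, of l] l by (simp add: A_def)
  then have "(l * A) powr (- q) \<le> (l * \<tau> * (1 / (2 * \<gamma>))) powr (- q)"
    using l \<tau> gam_nu_bounds q by (intro powr_mono2') auto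
  also have "\<dots> = (l * \<tau>) powr (- q) * (2 * \<gamma>) powr q"
  proof -
    have "(1 / (2 * \<gamma>)) powr (- q) = (2 * \<gamma>) powr q"
      using gam_nu_bounds by (simp add: powr_divide powr_minus_divide)
    moreover have "(l * \<tau> * (1 / (2 * \<gamma>))) powr (- q) = (l * \<tau>) powr (- q) * (1 / (2 * \<gamma>)) powr (- q)"
      by (rule powr_mult)
    ultimately show ?thesis by simp
  qed
  finally have q_le: "(l * A) powr (- q) \<le> (l * \<tau>) powr (- q) * (2 * \<gamma>) powr q" .
  have "phi_scaled N l x \<le> C * (l * A) powr (- q) * exp (l * A)"
    using C(2)[OF l(1), of x] A by (simp add: A_def q_def)
  also have "\<dots> \<le> C * ((l * \<tau>) powr (- q) * (2 * \<gamma>) powr q) * exp (l * A)"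
    using C(1) q_le by (intro mult_right_mono mult_left_mono) auto
  finally have P: "phi_scaled N l x \<le> C * ((l * \<tau>) powr (- q) * (2 * \<gamma>) powr q) * exp (l * A)" .
  have Y: "y_profile m (l * \<tau>) \<le> D * (l * \<tau>) powr (\<nu> - 1 / 2) * exp (- (l * \<tau> / \<gamma>))"
    using D(2)[of "l * \<tau>"] l \<tau> by simp
  have "y_profile m (l * \<tau>) * phi_scaled N l x
     \<le> (D * (l * \<tau>) powr (\<nu> - 1 / 2) * exp (- (l * \<tau> / \<gamma>))) * (C * ((l * \<tau>) powr (- q) * (2 * \<gamma>) powr q) * exp (l * A))"
    using D(1) phi_scaled_ge_1[OF N, of l x] by (intro mult_mono Y P) auto
  also have "\<dots> = D * C * (2 * \<gamma>) powr q * (((l * \<tau>) powr (\<nu> - 1 / 2) * (l * \<tau>) powr (- q)) * (exp (- (l * \<tau> / \<gamma>)) * exp (l * A)))"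
    by (simp only: mult_ac)
  also have "(l * \<tau>) powr (\<nu> - 1 / 2) * (l * \<tau>) powr (- q) = (l * \<tau>) powr (\<nu> - real N / 2)"
    unfolding powr_add[symmetric] by (simp add: q_def field_simps)
  also have "D * C * (2 * \<gamma>) powr q * ((l * \<tau>) powr (\<nu> - real N / 2) * (exp (- (l * \<tau> / \<gamma>)) * exp (l * A)))
     \<le> D * C * (2 * \<gamma>) powr q * ((l * \<tau>) powr (\<nu> - real N / 2) * (exp r0 * exp (- ((r0 + \<tau> / \<gamma> - A) * l))))"
    using D(1) C(1) l r0 by (intro mult_left_mono exp_shift_bound) auto
  finally show ?thesis by (simp add: A_def q_def mult_ac)
qed

text \<open>For |x| \<ge> \<tau> / (2 \<gamma>) the remaining power of l is p - 1 with p = \<beta> +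
  \<nu> - N / 2, and the hypothesis on \<beta> is exactly p > 0. For smaller |x| the crude bound
  gives \<sigma> powr (- \<beta>); there \<sigma> \<ge> \<tau> / (2 \<gamma>), so its factor
  \<sigma> powr (\<nu> - N / 2) can be traded for the same power of \<tau>.\<close>

lemma W_upper_near_cone:
  assumes \<beta>: "0 < \<beta>" "real N / 2 - \<nu> < \<beta>"
  obtains K where "0 < K" "\<And>x \<tau>. 0 < \<tau> \<Longrightarrow> norm_Rn N x < r0 + \<tau> / \<gamma> \<Longrightarrow>
    (\<integral>l. W_density \<beta> x \<tau> l \<partial>lborel)
      \<le> K * \<tau> powr (\<nu> - real N / 2) * (r0 + \<tau> / \<gamma> - norm_Rn N x) powr (- \<beta> - \<nu> + real N / 2)"
proof -
  obtain C where C: "0 < C" "\<And>l x. 0 < l \<Longrightarrow> 0 < norm_Rn N x \<Longrightarrow>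
      phi_scaled N l x \<le> C * (l * norm_Rn N x) powr (- ((real N - 1) / 2)) * exp (l * norm_Rn N x)"
    using phi_scaled_bound[OF N] by blast
  define p where "p = \<beta> + \<nu> - real N / 2"
  have p: "0 < p" using \<beta> by (simp add: p_def)
  define M where "M = mellin (\<lambda>s. exp (- s))"
  have M: "0 \<le> M r" for r unfolding M_def by (intro mellin_nonneg) auto
  define K1 where "K1 = D * C * exp r0 * (2 * \<gamma>) powr ((real N - 1) / 2) * M p"
  define K2 where "K2 = D * exp r0 * (2 * \<gamma>) powr (real N / 2 - \<nu>) * M \<beta>"
  have K: "0 \<le> K1" "0 \<le> K2" using D C M by (auto simp: K1_def K2_def)
  show ?thesis
  proof (rule that[of "K1 + K2 + 1"])
    show "0 < K1 + K2 + 1" using K by simp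
    fix x \<tau> assume \<tau>: "0 < \<tau>" and x: "norm_Rn N x < r0 + \<tau> / \<gamma>"
    define \<sigma> where "\<sigma> = r0 + \<tau> / \<gamma> - norm_Rn N x"
    have \<sigma>: "0 < \<sigma>" using x by (simp add: \<sigma>_def)
    let ?R = "\<tau> powr (\<nu> - real N / 2) * \<sigma> powr (- p)"
    have "(\<integral>l. W_density \<beta> x \<tau> l \<partial>lborel) \<le> max K1 K2 * ?R"
    proof (cases "\<tau> / (2 * \<gamma>) \<le> norm_Rn N x")
      case True
      let ?K = "D * C * exp r0 * (2 * \<gamma>) powr ((real N - 1) / 2) * \<tau> powr (\<nu> - real N / 2)"
      have "(\<integral>l. W_density \<beta> x \<tau> l \<partial>lborel) \<le> ?K * (\<sigma> powr (- p) * M p)"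
        unfolding M_def
      proof (rule W_le_mellin[OF \<beta>(1) \<tau> \<sigma> _ _ mellin_exp[OF p]])
        fix l :: real assume l: "0 < l" "l \<le> 1"
        have "y_profile m (l * \<tau>) * phi_scaled N l x * l powr (\<beta> - 1)
          \<le> D * C * exp r0 * (2 * \<gamma>) powr ((real N - 1) / 2) * ((l * \<tau>) powr (\<nu> - real N / 2) * exp (- (\<sigma> * l))) * l powr (\<beta> - 1)"
          using W_density_le_powr[OF C l \<tau> True] by (intro mult_right_mono) (auto simp: \<sigma>_def)
        also have "\<dots> = ?K * (exp (- (\<sigma> * l)) * (l powr (\<nu> - real N / 2) * l powr (\<beta> - 1)))"
          using l \<tau> by (simp add: powr_mult)
        also have "l powr (\<nu> - real N / 2) * l powr (\<beta> - 1) = l powr (p - 1)"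
          unfolding powr_add[symmetric] by (simp add: p_def algebra_simps)
        finally show "y_profile m (l * \<tau>) * phi_scaled N l x * l powr (\<beta> - 1) \<le> ?K * (exp (- (\<sigma> * l)) * l powr (p - 1))" .
      qed (use D C in auto)
      also have "\<dots> = K1 * ?R" by (simp add: K1_def)
      also have "\<dots> \<le> max K1 K2 * ?R" by (intro mult_right_mono) auto
      finally show ?thesis .
    next
      case False
      have "\<tau> / \<gamma> = 2 * (\<tau> / (2 * \<gamma>))" using gam_nu_bounds by simp
      then have "\<tau> / (2 * \<gamma>) \<le> \<sigma>" using False r0 unfolding \<sigma>_def by linarith
      then have "\<sigma> powr (\<nu> - real N / 2) \<le> (\<tau> / (2 * \<gamma>)) powr (\<nu> - real N / 2)"
        using \<tau> gam_nu_bounds N by (intro powr_mono2') auto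
      also have "\<dots> = \<tau> powr (\<nu> - real N / 2) * (2 * \<gamma>) powr (real N / 2 - \<nu>)"
      proof -
        have "(2 * \<gamma>) powr (real N / 2 - \<nu>) = 1 / (2 * \<gamma>) powr (\<nu> - real N / 2)"
          using powr_minus_divide[of "2 * \<gamma>" "\<nu> - real N / 2"] by simp
        then show ?thesis using \<tau> gam_nu_bounds by (simp add: powr_divide)
      qed
      finally have \<sigma>_le: "\<sigma> powr (\<nu> - real N / 2) \<le> \<tau> powr (\<nu> - real N / 2) * (2 * \<gamma>) powr (real N / 2 - \<nu>)" .
      have "\<sigma> powr (- \<beta>) = \<sigma> powr (- p) * \<sigma> powr (\<nu> - real N / 2)"
        unfolding powr_add[symmetric] by (simp add: p_def)
      also have "\<dots> \<le> \<sigma> powr (- p) * (\<tau> powr (\<nu> - real N / 2) * (2 * \<gamma>) powr (real N / 2 - \<nu>))"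
        using \<sigma>_le by (intro mult_left_mono) auto
      finally have s: "\<sigma> powr (- \<beta>) \<le> \<sigma> powr (- p) * (\<tau> powr (\<nu> - real N / 2) * (2 * \<gamma>) powr (real N / 2 - \<nu>))" .
      have "(\<integral>l. W_density \<beta> x \<tau> l \<partial>lborel) \<le> D * exp r0 * (\<sigma> powr (- \<beta>) * M \<beta>)"
        using W_le_exp[OF \<beta>(1) \<tau>, of x] \<sigma> by (simp add: \<sigma>_def M_def)
      also have "\<dots> \<le> D * exp r0 * (\<sigma> powr (- p) * (\<tau> powr (\<nu> - real N / 2) * (2 * \<gamma>) powr (real N / 2 - \<nu>)) * M \<beta>)"
        using s D M by (intro mult_left_mono mult_right_mono) auto
      also have "\<dots> = K2 * ?R" by (simp add: K2_def)
      also have "\<dots> \<le> max K1 K2 * ?R" by (intro mult_right_mono) auto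
      finally show ?thesis .
    qed
    also have "\<dots> \<le> (K1 + K2 + 1) * ?R" using K by (intro mult_right_mono) auto
    finally show "(\<integral>l. W_density \<beta> x \<tau> l \<partial>lborel)
      \<le> (K1 + K2 + 1) * \<tau> powr (\<nu> - real N / 2) * (r0 + \<tau> / \<gamma> - norm_Rn N x) powr (- \<beta> - \<nu> + real N / 2)"
      by (simp add: \<sigma>_def p_def mult.assoc algebra_simps)
  qed
qed

text \<open>Here \<beta> + \<nu> - N / 2 < 0, so the power decay at scale l = 1 / \<tau> converges
  at infinity and the bound does not involve the distance \<sigma> to the cone. For |x| < \<tau> /
  (2 \<gamma>) the crude bound suffices, as \<sigma> is then at least \<tau> / (2 \<gamma>).\<close>

lemma W_upper_interior:
  assumes \<beta>: "0 < \<beta>" "\<beta> < real N / 2 - \<nu>"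
  obtains K where "0 < K" "\<And>x \<tau>. 0 < \<tau> \<Longrightarrow> norm_Rn N x < r0 + \<tau> / \<gamma> \<Longrightarrow>
    (\<integral>l. W_density \<beta> x \<tau> l \<partial>lborel) \<le> K * \<tau> powr (- \<beta>)"
proof -
  obtain C where C: "0 < C" "\<And>l x. 0 < l \<Longrightarrow> 0 < norm_Rn N x \<Longrightarrow>
      phi_scaled N l x \<le> C * (l * norm_Rn N x) powr (- ((real N - 1) / 2)) * exp (l * norm_Rn N x)"
    using phi_scaled_bound[OF N] by blast
  define h where "h = trunc_powr (\<nu> - real N / 2)"
  have h: "0 \<le> h s" for s by (simp add: h_def trunc_powr_def)
  define B where "B = max (D * exp r0) (D * C * exp r0 * (2 * \<gamma>) powr ((real N - 1) / 2))"
  have B: "0 \<le> B" using D by (simp add: B_def le_max_iff_disj)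
  define K1 where "K1 = B * mellin h \<beta>"
  define K2 where "K2 = D * exp r0 * mellin (\<lambda>s. exp (- s)) \<beta> * (2 * \<gamma>) powr \<beta>"
  have K: "0 \<le> K1" "0 \<le> K2" using B D h by (auto simp: K1_def K2_def intro!: mult_nonneg_nonneg mellin_nonneg)
  show ?thesis
  proof (rule that[of "K1 + K2 + 1"])
    show "0 < K1 + K2 + 1" using K by simp
    fix x \<tau> assume \<tau>: "0 < \<tau>" and x: "norm_Rn N x < r0 + \<tau> / \<gamma>"
    define \<sigma> where "\<sigma> = r0 + \<tau> / \<gamma> - norm_Rn N x"
    have \<sigma>: "0 < \<sigma>" using x by (simp add: \<sigma>_def)
    have "(\<integral>l. W_density \<beta> x \<tau> l \<partial>lborel) \<le> max K1 K2 * \<tau> powr (- \<beta>)"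
    proof (cases "\<tau> / (2 * \<gamma>) \<le> norm_Rn N x")
      case True
      have "(\<integral>l. W_density \<beta> x \<tau> l \<partial>lborel) \<le> B * (\<tau> powr (- \<beta>) * mellin h \<beta>)"
      proof (rule W_le_mellin[OF \<beta>(1) \<tau> \<tau> B h])
        show "mellin_integrable h \<beta>" unfolding h_def using \<beta> by (intro mellin_trunc_powr) auto
        fix l :: real assume l: "0 < l" "l \<le> 1"
        have e: "exp (- (\<sigma> * l)) \<le> 1" using \<sigma> l by simp
        have "y_profile m (l * \<tau>) * phi_scaled N l x \<le> B * h (\<tau> * l)"
        \<comment> \<open>The power (l * \<tau>) powr (\<nu> - N / 2) blows up at 0, so below l = 1
          / \<tau> the constant from the exponential bound is used instead.\<close>
        proof (cases "\<tau> * l \<le> 1")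
          case True
          have "y_profile m (l * \<tau>) * phi_scaled N l x \<le> D * exp r0 * exp (- (\<sigma> * l))"
            using W_density_le_exp[OF l \<tau>, of x] by (simp add: \<sigma>_def)
          also have "\<dots> \<le> D * exp r0 * 1" using e D by (intro mult_left_mono) auto
          also have "\<dots> \<le> B * h (\<tau> * l)" using True by (simp add: h_def trunc_powr_def B_def)
          finally show ?thesis .
        next
          case False
          have "y_profile m (l * \<tau>) * phi_scaled N l x
            \<le> D * C * exp r0 * (2 * \<gamma>) powr ((real N - 1) / 2) * ((l * \<tau>) powr (\<nu> - real N / 2) * exp (- (\<sigma> * l)))"
            using W_density_le_powr[OF C l \<tau> \<open>\<tau> / (2 * \<gamma>) \<le> norm_Rn N x\<close>] by (simp add: \<sigma>_def)
          also have "\<dots> \<le> B * ((l * \<tau>) powr (\<nu> - real N / 2) * 1)"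
            using e B by (intro mult_mono) (auto simp: B_def)
          also have "\<dots> = B * h (\<tau> * l)" using False by (simp add: h_def trunc_powr_def mult.commute)
          finally show ?thesis .
        qed
        then have "y_profile m (l * \<tau>) * phi_scaled N l x * l powr (\<beta> - 1) \<le> B * h (\<tau> * l) * l powr (\<beta> - 1)"
          by (intro mult_right_mono) auto
        then show "y_profile m (l * \<tau>) * phi_scaled N l x * l powr (\<beta> - 1) \<le> B * (h (\<tau> * l) * l powr (\<beta> - 1))"
          by (simp add: mult.assoc)
      qed
      also have "\<dots> = K1 * \<tau> powr (- \<beta>)" by (simp add: K1_def)
      also have "\<dots> \<le> max K1 K2 * \<tau> powr (- \<beta>)" by (intro mult_right_mono) auto
      finally show ?thesis .
    next
      case False
      have "\<tau> / \<gamma> = 2 * (\<tau> / (2 * \<gamma>))" using gam_nu_bounds by simp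
      then have "\<tau> / (2 * \<gamma>) \<le> \<sigma>" using False r0 unfolding \<sigma>_def by linarith
      then have "\<sigma> powr (- \<beta>) \<le> (\<tau> / (2 * \<gamma>)) powr (- \<beta>)"
        using \<tau> gam_nu_bounds \<beta> by (intro powr_mono2') auto
      also have "\<dots> = \<tau> powr (- \<beta>) * (2 * \<gamma>) powr \<beta>"
        using \<tau> gam_nu_bounds by (simp add: powr_divide powr_minus_divide)
      finally have s: "\<sigma> powr (- \<beta>) \<le> \<tau> powr (- \<beta>) * (2 * \<gamma>) powr \<beta>" .
      have "(\<integral>l. W_density \<beta> x \<tau> l \<partial>lborel) \<le> D * exp r0 * (\<sigma> powr (- \<beta>) * mellin (\<lambda>s. exp (- s)) \<beta>)"
        using W_le_exp[OF \<beta>(1) \<tau>, of x] \<sigma> by (simp add: \<sigma>_def)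
      also have "\<dots> \<le> D * exp r0 * (\<tau> powr (- \<beta>) * (2 * \<gamma>) powr \<beta> * mellin (\<lambda>s. exp (- s)) \<beta>)"
        using s D by (intro mult_left_mono mult_right_mono mellin_nonneg) auto
      also have "\<dots> = K2 * \<tau> powr (- \<beta>)" by (simp add: K2_def)
      also have "\<dots> \<le> max K1 K2 * \<tau> powr (- \<beta>)" by (intro mult_right_mono) auto
      finally show ?thesis .
    qed
    also have "\<dots> \<le> (K1 + K2 + 1) * \<tau> powr (- \<beta>)" using K by (intro mult_right_mono) auto
    finally show "(\<integral>l. W_density \<beta> x \<tau> l \<partial>lborel) \<le> (K1 + K2 + 1) * \<tau> powr (- \<beta>)" .
  qed
qed

end

end

theorem proposition2p4:
  fixes m T0 :: real
  assumes "0 \<le> m" and "is_T0 m T0"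
  shows
    "(\<exists>C>1. \<forall>N\<ge>1. \<forall>\<beta>>0. \<forall>x\<in>Rn N. \<forall>t>1.
        (\<lambda>s. Wfun N \<beta> m x s) differentiable (at t) \<and>
        \<bar>deriv (\<lambda>s. Wfun N \<beta> m x s) t\<bar>
          \<le> C * exp (t powr (- gam m) * norm_Rn N x) * t powr (- (gam m * (\<beta> + 1 / gam m)))
            + C * t powr (m / 2) * Wfun N (\<beta> + 1) m x t)
   \<and> (\<forall>\<beta>>0. \<exists>C>0. \<forall>N\<ge>1. \<forall>x\<in>Rn N. \<forall>t>(2 * T0) powr (1 / gam m).
        Wfun N \<beta> m x t \<ge> C * t powr (- ((m + 2) / 2 * \<beta>)))
   \<and> (\<forall>N\<ge>1. \<forall>\<beta>>0. \<forall>r0>0. \<beta> > real N / 2 - 1 / (m + 2) \<longrightarrow>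
        (\<exists>C>0. \<forall>x\<in>Rn N. \<forall>t>T0 powr (1 / gam m).
           norm_Rn N x < r0 + 1 / gam m * t powr gam m \<longrightarrow>
           Wfun N \<beta> m x t
             \<le> C * t powr (- (m / 4) - (real N - 1) * (m + 2) / 4)
               * (r0 + 1 / gam m * t powr gam m - norm_Rn N x) powr (- \<beta> - 1 / (m + 2) + real N / 2)))
   \<and> (\<forall>N\<ge>2. \<forall>\<beta>>0. \<forall>r0>0.
        1 / 2 - 1 / (m + 2) < \<beta> \<and> \<beta> < real N / 2 - 1 / (m + 2) \<longrightarrow>
        (\<exists>C>0. \<forall>x\<in>Rn N. \<forall>t>T0 powr (1 / gam m).
           norm_Rn N x < r0 + 1 / gam m * t powr gam m \<longrightarrow>
           Wfun N \<beta> m x t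
             \<le> C * t powr (- (m / 4))
               * (r0 + 1 / gam m * t powr gam m + norm_Rn N x) powr (- \<beta> + 1 / 2 - 1 / (m + 2))))"
proof -
  note m = assms(1)
  have T0: "1 \<le> T0" using assms(2) by (simp add: is_T0_def)
  define \<gamma> where "\<gamma> = gam m"
  define \<nu> where "\<nu> = 1 / (2 * gam m)"
  have \<gamma>: "0 < \<gamma>" "1 \<le> \<gamma>" "\<gamma> = (m + 2) / 2" and \<nu>: "\<nu> = 1 / (m + 2)" "\<gamma> * \<nu> = 1 / 2"
    using m by (auto simp: \<gamma>_def \<nu>_def gam_def field_simps)
  obtain D where D: "0 < D" "\<And>s. 0 < s \<Longrightarrow> y_profile m s \<le> D * s powr (\<nu> - 1 / 2) * exp (- (s / \<gamma>))"
      "\<And>s. 0 < s \<Longrightarrow> y_profile m s \<le> D * exp (- (s / \<gamma>))"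
    using y_profile_decay[OF m assms(2)] unfolding \<gamma>_def \<nu>_def by metis
  \<comment> \<open>As T0 \<ge> 1, the time ranges of parts 2 to 4 all lie in t > 1.\<close>
  have t_gt: "1 \<le> c powr (1 / \<gamma>)" if "1 \<le> c" for c :: real
    using that \<gamma> by (intro ge_one_powr_ge_zero) auto
  have part1: "\<exists>C>1. \<forall>N\<ge>1. \<forall>\<beta>>0. \<forall>x\<in>Rn N. \<forall>t>1.
        (\<lambda>s. Wfun N \<beta> m x s) differentiable (at t) \<and>
        \<bar>deriv (\<lambda>s. Wfun N \<beta> m x s) t\<bar>
          \<le> C * exp (t powr (- gam m) * norm_Rn N x) * t powr (- (gam m * (\<beta> + 1 / gam m)))
            + C * t powr (m / 2) * Wfun N (\<beta> + 1) m x t"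
  proof -
    obtain C where C: "0 < C" "\<And>s. 0 < s \<Longrightarrow> \<bar>y_slope m s\<bar> \<le> C * s powr (2 * (1 / (2 * gam m)) - 1)"
      "\<And>s. 1 \<le> s \<Longrightarrow> \<bar>y_slope m s\<bar> \<le> C * y_profile m s"
      by (rule y_slope_bound[OF m]) blast
    show ?thesis
    proof (intro exI[of _ "C * (gam m)\<^sup>2 + 1"] conjI allI impI ballI)
      show "1 < C * (gam m)\<^sup>2 + 1" using C \<gamma> by (simp add: \<gamma>_def)
    qed (use W_deriv_bound[OF m _ _ _ C] in auto)
  qed
  have part2: "\<forall>\<beta>>0. \<exists>C>0. \<forall>N\<ge>1. \<forall>x\<in>Rn N. \<forall>t>(2 * T0) powr (1 / gam m).
        Wfun N \<beta> m x t \<ge> C * t powr (- ((m + 2) / 2 * \<beta>))"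
  proof (intro allI impI)
    fix \<beta> :: real assume \<beta>: "0 < \<beta>"
    show "\<exists>C>0. \<forall>N\<ge>1. \<forall>x\<in>Rn N. \<forall>t>(2 * T0) powr (1 / gam m).
        Wfun N \<beta> m x t \<ge> C * t powr (- ((m + 2) / 2 * \<beta>))"
    proof (intro exI[of _ "y_profile m 1 / \<beta>"] conjI allI impI ballI)
      show "0 < y_profile m 1 / \<beta>" using y_profile_pos[OF m, of 1] \<beta> by simp
      fix N :: nat and x t assume N: "1 \<le> N" and t: "(2 * T0) powr (1 / gam m) < t"
      have "1 < t" using t t_gt[of "2 * T0"] T0 by (simp add: \<gamma>_def)
      then show "y_profile m 1 / \<beta> * t powr (- ((m + 2) / 2 * \<beta>)) \<le> Wfun N \<beta> m x t"
        using W_lower_bound[OF m N \<beta>, of t x] by (simp add: gam_def)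
    qed
  qed
  have part3: "\<exists>C>0. \<forall>x\<in>Rn N. \<forall>t>T0 powr (1 / gam m).
           norm_Rn N x < r0 + 1 / gam m * t powr gam m \<longrightarrow>
           Wfun N \<beta> m x t
             \<le> C * t powr (- (m / 4) - (real N - 1) * (m + 2) / 4)
               * (r0 + 1 / gam m * t powr gam m - norm_Rn N x) powr (- \<beta> - 1 / (m + 2) + real N / 2)"
    if N: "1 \<le> N" and \<beta>: "0 < \<beta>" and r0: "0 < r0" and \<beta>': "\<beta> > real N / 2 - 1 / (m + 2)"
    for N :: nat and \<beta> r0 :: real
  proof -
    obtain K where K: "0 < K" "\<And>x \<tau>. 0 < \<tau> \<Longrightarrow> norm_Rn N x < r0 + \<tau> / \<gamma> \<Longrightarrow>
      (\<integral>l. W_density m N \<beta> x \<tau> l \<partial>lborel)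
        \<le> K * \<tau> powr (\<nu> - real N / 2) * (r0 + \<tau> / \<gamma> - norm_Rn N x) powr (- \<beta> - \<nu> + real N / 2)"
      using W_upper_near_cone[OF m N D(1) D(2,3)[unfolded \<gamma>_def \<nu>_def] r0 \<beta>] \<beta>' \<nu> unfolding \<gamma>_def \<nu>_def
      by metis
    show ?thesis
    proof (intro exI[of _ K] conjI ballI allI impI K(1))
      fix x t assume t: "T0 powr (1 / gam m) < t" and x: "norm_Rn N x < r0 + 1 / gam m * t powr gam m"
      have t1: "1 < t" using t t_gt[of T0] T0 by (simp add: \<gamma>_def)
      have "\<gamma> * (\<nu> - real N / 2) = - (m / 4) - (real N - 1) * (m + 2) / 4"
        unfolding right_diff_distrib \<nu>(2) by (simp add: \<gamma>(3) field_simps)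
      then have "(t powr \<gamma>) powr (\<nu> - real N / 2) = t powr (- (m / 4) - (real N - 1) * (m + 2) / 4)"
        by (simp add: powr_powr)
      then show "Wfun N \<beta> m x t
             \<le> K * t powr (- (m / 4) - (real N - 1) * (m + 2) / 4)
               * (r0 + 1 / gam m * t powr gam m - norm_Rn N x) powr (- \<beta> - 1 / (m + 2) + real N / 2)"
        using K(2)[of "t powr \<gamma>" x] x t1 Wfun_eq[OF m N, of t \<beta> x] by (simp add: \<nu>(1) \<gamma>_def)
    qed
  qed
  have part4: "\<exists>C>0. \<forall>x\<in>Rn N. \<forall>t>T0 powr (1 / gam m).
           norm_Rn N x < r0 + 1 / gam m * t powr gam m \<longrightarrow>
           Wfun N \<beta> m x t
             \<le> C * t powr (- (m / 4))
               * (r0 + 1 / gam m * t powr gam m + norm_Rn N x) powr (- \<beta> + 1 / 2 - 1 / (m + 2))"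
    if N: "1 \<le> N" and \<beta>: "0 < \<beta>" and r0: "0 < r0"
      and \<beta>': "1 / 2 - 1 / (m + 2) < \<beta>" "\<beta> < real N / 2 - 1 / (m + 2)"
    for N :: nat and \<beta> r0 :: real
  proof -
    obtain K where K: "0 < K" "\<And>x \<tau>. 0 < \<tau> \<Longrightarrow> norm_Rn N x < r0 + \<tau> / \<gamma> \<Longrightarrow>
      (\<integral>l. W_density m N \<beta> x \<tau> l \<partial>lborel) \<le> K * \<tau> powr (- \<beta>)"
      using W_upper_interior[OF m N D(1) D(2,3)[unfolded \<gamma>_def \<nu>_def] r0 \<beta>] \<beta>' \<nu> unfolding \<gamma>_def \<nu>_def
      by metis
    \<comment> \<open>\<open>W_upper_interior\<close> gives \<tau> powr (- \<beta>), and - \<beta> =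
      (\<nu> - 1 / 2) + e: the first summand is the factor t powr (- (m / 4)), the second is to
      become a power of r0 + \<tau> / \<gamma> + |x|. The lower bound on \<beta> makes e
      negative.\<close>
    define e where "e = - \<beta> + 1 / 2 - 1 / (m + 2)"
    have e: "e < 0" using \<beta>' by (simp add: e_def)
    \<comment> \<open>Since |x| < r0 + \<tau> / \<gamma> and \<tau> > 1, the sum r0 + \<tau> /
      \<gamma> + |x| is at most \<kappa> * \<tau>; the negative exponent e reverses this into the
      required bound.\<close>
    define \<kappa> where "\<kappa> = 2 * (r0 + 1 / \<gamma>)"
    have \<kappa>: "0 < \<kappa>" using r0 \<gamma> by (simp add: \<kappa>_def add_pos_pos)
    show ?thesis
    proof (intro exI[of _ "K / \<kappa> powr e"] conjI ballI allI impI)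
      show "0 < K / \<kappa> powr e" using K \<kappa> by simp
      fix x t assume t: "T0 powr (1 / gam m) < t" and x: "norm_Rn N x < r0 + 1 / gam m * t powr gam m"
      have t1: "1 < t" using t t_gt[of T0] T0 by (simp add: \<gamma>_def)
      define \<tau> where "\<tau> = t powr \<gamma>"
      have \<tau>: "1 < \<tau>" unfolding \<tau>_def using t1 \<gamma> by (intro gr_one_powr) auto
      have x': "norm_Rn N x < r0 + \<tau> / \<gamma>" using x by (simp add: \<tau>_def \<gamma>_def)
      have "r0 * 1 \<le> r0 * \<tau>" using r0 \<tau> by (intro mult_left_mono) auto
      moreover have "\<kappa> * \<tau> = 2 * (r0 * \<tau>) + 2 * (\<tau> / \<gamma>)" by (simp add: \<kappa>_def algebra_simps)
      ultimately have "r0 + \<tau> / \<gamma> + norm_Rn N x \<le> \<kappa> * \<tau>" using x' by linarith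
      moreover have "0 < r0 + \<tau> / \<gamma> + norm_Rn N x" using r0 \<tau> \<gamma> by (intro add_pos_nonneg) auto
      ultimately have "(\<kappa> * \<tau>) powr e \<le> (r0 + \<tau> / \<gamma> + norm_Rn N x) powr e"
        using e by (intro powr_mono2') auto
      then have "\<tau> powr e \<le> 1 / \<kappa> powr e * (r0 + \<tau> / \<gamma> + norm_Rn N x) powr e"
        using \<kappa> \<tau> by (simp add: powr_mult field_simps)
      then have "\<tau> powr (\<nu> - 1 / 2) * \<tau> powr e \<le> \<tau> powr (\<nu> - 1 / 2) * (1 / \<kappa> powr e * (r0 + \<tau> / \<gamma> + norm_Rn N x) powr e)"
        by (intro mult_left_mono) auto
      moreover have "\<tau> powr (\<nu> - 1 / 2) * \<tau> powr e = \<tau> powr (- \<beta>)"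
        unfolding powr_add[symmetric] by (simp add: e_def \<nu>(1))
      moreover have "\<tau> powr (\<nu> - 1 / 2) = t powr (- (m / 4))"
      proof -
        have "\<gamma> * (\<nu> - 1 / 2) = - (m / 4)"
          unfolding right_diff_distrib \<nu>(2) by (simp add: \<gamma>(3) field_simps)
        then show ?thesis by (simp add: \<tau>_def powr_powr)
      qed
      ultimately have "K * \<tau> powr (- \<beta>) \<le> K * (t powr (- (m / 4)) * (1 / \<kappa> powr e * (r0 + \<tau> / \<gamma> + norm_Rn N x) powr e))"
        using K(1) by (intro mult_left_mono) auto
      then have "Wfun N \<beta> m x t \<le> K / \<kappa> powr e * t powr (- (m / 4)) * (r0 + \<tau> / \<gamma> + norm_Rn N x) powr e"
        using K(2)[of \<tau> x] x' \<tau> t1 Wfun_eq[OF m N, of t \<beta> x]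
        by (simp add: \<gamma>_def[symmetric] \<tau>_def[symmetric] mult_ac)
      then show "Wfun N \<beta> m x t \<le> K / \<kappa> powr e * t powr (- (m / 4))
               * (r0 + 1 / gam m * t powr gam m + norm_Rn N x) powr (- \<beta> + 1 / 2 - 1 / (m + 2))"
        by (simp add: e_def \<gamma>_def \<tau>_def)
    qed
  qed
  show ?thesis
    using part1 part2 part3 part4 by (intro conjI allI impI) auto
qed

end
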